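(* For every integer $k \geq 3$ there exists a holomorphic automorphism $F$ of $\mathbb{C}^k$ which is tangent to the identity at the origin $O$ and whose basin of attraction $\Omega = \{p \in \mathbb{C}^k \setminus \{O\} : F^n(p) \to O \text{ as } n \to \infty\}$ is an open set that is biholomorphic to $(\mathbb{C}^* )^{k-2} \times \mathbb{C}^2$.
   Context: $O$ denotes the origin of $\mathbb{C}^k$, and $\mathbb{C}^* = \mathbb{C} \setminus \{0\}$. An automorphism of $\mathbb{C}^k$ is a biholomorphic map $F : \mathbb{C}^k \to \mathbb{C}^k$. $F$ is tangent to the identity at $O$ if $F(O) = O$ and $DF(O) = \mathrm{Id}$. $F^n$ denotes the $n$-th iterate of $F$. The basin of attraction of $F$ is the set of points other than $O$ whose forward orbit under $F$ converges to $O$; the term is used when this set is open. *)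

theory Defs
  imports "HOL-Analysis.Analysis"
begin

text \<open>
  The space $\mathbb{C}^k$ is \<open>complex ^ 'k\<close> with \<open>CARD('k) = k\<close>. The relation \<open>has_derivative\<close>
  is real Frechet differentiability, so complex linearity of the derivative, i.e. linearity
  with respect to \<open>(*s)\<close>, has to be required separately.
\<close>

definition holomorphic_map_on ::
    "(complex ^ 'n::finite \<Rightarrow> complex ^ 'm::finite) \<Rightarrow> (complex ^ 'n) set \<Rightarrow> bool" where
  "holomorphic_map_on f U \<longleftrightarrow>
     open U \<and> (\<forall>z\<in>U. \<exists>D. Vector_Spaces.linear (*s) (*s) D \<and> (f has_derivative D) (at z))"

definition biholomorphism ::
    "(complex ^ 'n::finite \<Rightarrow> complex ^ 'm::finite) \<Rightarrow> (complex ^ 'n) set \<Rightarrow> (complex ^ 'm) set \<Rightarrow> bool" where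
  "biholomorphism f U V \<longleftrightarrow>
     bij_betw f U V \<and> holomorphic_map_on f U \<and> holomorphic_map_on (inv_into U f) V"

definition biholomorphic ::
    "(complex ^ 'n::finite) set \<Rightarrow> (complex ^ 'm::finite) set \<Rightarrow> bool" where
  "biholomorphic U V \<longleftrightarrow> (\<exists>f. biholomorphism f U V)"

definition holomorphic_automorphism :: "(complex ^ 'k::finite \<Rightarrow> complex ^ 'k) \<Rightarrow> bool" where
  "holomorphic_automorphism F \<longleftrightarrow> biholomorphism F UNIV UNIV"

definition tangent_to_identity :: "(complex ^ 'k::finite \<Rightarrow> complex ^ 'k) \<Rightarrow> bool" where
  "tangent_to_identity F \<longleftrightarrow> F 0 = 0 \<and> (F has_derivative (\<lambda>v. v)) (at 0)"

definition basin_of_attraction :: "(complex ^ 'k::finite \<Rightarrow> complex ^ 'k) \<Rightarrow> (complex ^ 'k) set" where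
  "basin_of_attraction F = {p. p \<noteq> 0 \<and> (\<lambda>n. (F ^^ n) p) \<longlonglongrightarrow> 0}"

text \<open>
  The index type carries no order, so the coordinates ranging over $\mathbb{C}^*$ are singled out
  by a set \<open>S\<close> of indices: the set below is $(\mathbb{C}^*)^{s} \times \mathbb{C}^{k-s}$ with
  \<open>s = card S\<close>, up to the order of the factors.
\<close>

definition punctured_coords :: "'k::finite set \<Rightarrow> (complex ^ 'k) set" where
  "punctured_coords S = {z. \<forall>i\<in>S. z $ i \<noteq> 0}"

end

theory Submission
  imports Defs "HOL-Complex_Analysis.Cauchy_Integral_Formula"
begin

text \<open>
  The automorphism is a lift of a map of $\mathbb{C}^2$. Single out one coordinate $u$ of
  $\mathbb{C}^k$ and let $v$ be the product of the other $k - 1$ coordinates $x_i$. If $G$ is an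
  automorphism of $\mathbb{C}^2$ of the form $G(u, v) = (g(u, v), v e^{h(u, v)})$, then
  $(u, x_i) \mapsto (g(u, v), x_i e^{h(u, v) / (k - 1)})$ is an automorphism of $\mathbb{C}^k$ that
  projects to $G$, whatever $h$ is. The same factor multiplies every $x_i$, so along an orbit
  $x_i^{k - 1} / v$ is constant; off the hypersurface $v = 0$ an orbit upstairs therefore tends to
  $O$ exactly when its projection tends to $(0, 0)$. The map \<open>base_map\<close> used for $G$ fixes the
  line $v = 0$ pointwise, so its lift fixes the hypersurface $v = 0$ pointwise and no point of it
  other than $O$ converges to $O$. Hence the basin is the set of points whose projection lies in
  the basin $B$ of $G$ off the line $v = 0$, and forgetting one of the coordinates $x_i$ shows it to be
  $B \times (\mathbb{C}^*)^{k - 2}$, because that coordinate is determined by $v$ and the others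
  (\<open>basin_lift\<close>, \<open>lift_fatou_biholomorphism\<close>). It remains to choose $G$ with $B$ biholomorphic
  to $\mathbb{C}^2$.

  The map $G$ is a composition of shears and overshears arranged so that in the coordinates
  $U = 1 / v$, $t = u / v$ it is $(U, t) \mapsto (U + 1, t)$ up to errors that are quadratic in $v$
  when $t$ is bounded (\<open>base_asymptotics\<close>). Two features make this work. First, $1 / v$ increases by
  approximately $1$ as soon as $u$ and $v$ are small, whatever the ratio $u / v$ is, so every orbit in
  $B$ has $1 / v$ tending to infinity along the positive real direction; a discrete Gronwall
  argument then bounds $u / v$, and the orbit enters one of the petals $\mathrm{Re}\, U > R$,
  $|t| < M$ (\<open>basin_enters_petal\<close>). Secondly, the errors are summable along orbits in a
  petal, so $(U_n - n, t_n)$ converges, locally uniformly, to a holomorphic Fatou map \<open>fatou\<close> that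
  conjugates $G$ to $(\zeta, t) \mapsto (\zeta + 1, t)$ (\<open>petal_uniform_limit\<close>, \<open>fatou_base_pow\<close>).

  In a petal the Fatou map differs from the coordinates $(U, t)$ by a holomorphic map bounded by a
  small constant, hence, by Cauchy's estimate, by a map with a small Lipschitz constant. It is
  therefore injective there with invertible derivative, and Brouwer's theorem shows that it
  attains every value whose first component is far enough to the right. Transport by the dynamics
  turns these local facts into bijectivity of the Fatou map from $B$ onto $\mathbb{C}^2$ (\<open>fatou_inj\<close>, \<open>fatou_surj\<close>,
  \<open>cdiff_fatou_inverse\<close>).
\<close>

section \<open>Complex differentiability\<close>

text \<open>The scalar multiplications are parameters because three of them occur: \<open>(*)\<close> on the complex
  numbers, \<open>(*s)\<close> on vectors and \<open>pscale\<close> on pairs, whose product type carries only the real one.\<close>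
definition cdiff ::
    "(complex \<Rightarrow> 'a \<Rightarrow> 'a) \<Rightarrow> (complex \<Rightarrow> 'b \<Rightarrow> 'b) \<Rightarrow>
      ('a::real_normed_vector \<Rightarrow> 'b::real_normed_vector) \<Rightarrow> 'a \<Rightarrow> bool" where
  "cdiff s t f p \<longleftrightarrow> (\<exists>D. (f has_derivative D) (at p) \<and> (\<forall>c x. D (s c x) = t c (D x)))"

definition pscale :: "complex \<Rightarrow> complex \<times> complex \<Rightarrow> complex \<times> complex" where
  "pscale c p = (c * fst p, c * snd p)"

lemma cdiffI:
  "(f has_derivative D) (at p) \<Longrightarrow> (\<And>c x. D (s c x) = t c (D x)) \<Longrightarrow> cdiff s t f p"
  unfolding cdiff_def by blast

lemma cdiff_continuous: "cdiff s t f p \<Longrightarrow> isCont f p"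
  unfolding cdiff_def using has_derivative_continuous by blast

lemma cdiff_const: "cdiff s (*) (\<lambda>x. c) p"
  by (rule cdiffI[where D = "\<lambda>x. 0"]) auto

lemma cdiff_add:
  assumes "cdiff s (*) f p" "cdiff s (*) g p" shows "cdiff s (*) (\<lambda>x. f x + g x) p"
proof -
  obtain D where D: "(f has_derivative D) (at p)" "\<And>c x. D (s c x) = c * D x"
    using assms(1) unfolding cdiff_def by blast
  obtain D' where "(g has_derivative D') (at p)" "\<And>c x. D' (s c x) = c * D' x"
    using assms(2) unfolding cdiff_def by blast
  with D show ?thesis
    by (intro cdiffI[where D = "\<lambda>x. D x + D' x"]) (simp_all add: has_derivative_add distrib_left)
qed

lemma cdiff_mult:
  fixes f g :: "_ \<Rightarrow> complex"
  assumes "cdiff s (*) f p" "cdiff s (*) g p" shows "cdiff s (*) (\<lambda>x. f x * g x) p"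
proof -
  obtain D where D: "(f has_derivative D) (at p)" "\<And>c x. D (s c x) = c * D x"
    using assms(1) unfolding cdiff_def by blast
  obtain D' where "(g has_derivative D') (at p)" "\<And>c x. D' (s c x) = c * D' x"
    using assms(2) unfolding cdiff_def by blast
  with D show ?thesis
    by (intro cdiffI[where D = "\<lambda>x. f p * D' x + D x * g p"] has_derivative_mult)
       (auto simp: algebra_simps)
qed

lemma cdiff_comp:
  assumes "cdiff s t f p" "cdiff t r g (f p)" shows "cdiff s r (\<lambda>x. g (f x)) p"
proof -
  obtain D where D: "(f has_derivative D) (at p)" "\<And>c x. D (s c x) = t c (D x)"
    using assms(1) unfolding cdiff_def by blast
  obtain D' where D': "(g has_derivative D') (at (f p))" "\<And>c x. D' (t c x) = r c (D' x)"
    using assms(2) unfolding cdiff_def by blast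
  show ?thesis
    by (rule cdiffI[OF has_derivative_compose[OF D(1) D'(1)]]) (simp only: D(2) D'(2))
qed

lemma cdiff_deriv_comp:
  assumes "cdiff s (*) f p" "(g has_field_derivative g') (at (f p))"
  shows "cdiff s (*) (\<lambda>x. g (f x)) p"
proof (rule cdiff_comp[OF assms(1)])
  show "cdiff (*) (*) g (f p)"
    using assms(2) by (intro cdiffI[where D = "(*) g'"]) (auto simp: has_field_derivative_def)
qed

lemma cdiff_exp: "cdiff s (*) f p \<Longrightarrow> cdiff s (*) (\<lambda>x. exp (f x :: complex)) p"
  by (erule cdiff_deriv_comp) (rule DERIV_exp)

lemma cdiff_minus:
  fixes f :: "_ \<Rightarrow> complex"
  assumes "cdiff s (*) f p" shows "cdiff s (*) (\<lambda>x. - f x) p"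
  using cdiff_mult[OF cdiff_const[of s "-1"] assms] by simp

lemma cdiff_diff:
  fixes f g :: "_ \<Rightarrow> complex"
  assumes "cdiff s (*) f p" "cdiff s (*) g p" shows "cdiff s (*) (\<lambda>x. f x - g x) p"
  using cdiff_add[OF assms(1) cdiff_minus[OF assms(2)]] by simp

lemma cdiff_power:
  fixes f :: "_ \<Rightarrow> complex"
  assumes "cdiff s (*) f p" shows "cdiff s (*) (\<lambda>x. f x ^ n) p"
  by (induction n) (auto intro: cdiff_const cdiff_mult assms)

lemma cdiff_inverse:
  fixes f :: "_ \<Rightarrow> complex"
  assumes "cdiff s (*) f p" "f p \<noteq> 0" shows "cdiff s (*) (\<lambda>x. inverse (f x)) p"
  using assms(1) DERIV_inverse[OF assms(2)] by (rule cdiff_deriv_comp)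

lemma cdiff_divide:
  fixes f g :: "_ \<Rightarrow> complex"
  assumes "cdiff s (*) f p" "cdiff s (*) g p" "g p \<noteq> 0"
  shows "cdiff s (*) (\<lambda>x. f x / g x) p"
  using cdiff_mult[OF assms(1) cdiff_inverse[OF assms(2,3)]] by (simp add: divide_inverse)

lemma cdiff_prod:
  fixes f :: "_ \<Rightarrow> _ \<Rightarrow> complex"
  assumes "\<And>i. i \<in> A \<Longrightarrow> cdiff s (*) (f i) p"
  shows "cdiff s (*) (\<lambda>x. \<Prod>i\<in>A. f i x) p"
  using assms by (induction A rule: infinite_finite_induct) (auto intro: cdiff_const cdiff_mult)

lemma cdiff_fst: "cdiff pscale (*) fst p" and cdiff_snd: "cdiff pscale (*) snd p"
  by (rule cdiffI[OF bounded_linear.has_derivative[OF bounded_linear_fst has_derivative_ident]],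
      simp add: pscale_def,
      rule cdiffI[OF bounded_linear.has_derivative[OF bounded_linear_snd has_derivative_ident]],
      simp add: pscale_def)

lemma cdiff_nth: "cdiff (*s) (*) (\<lambda>x. x $ i) p"
  by (rule cdiffI[where D = "\<lambda>x. x $ i"])
     (simp_all add: bounded_linear.has_derivative[OF bounded_linear_vec_nth])

lemma cdiff_id: "cdiff s s (\<lambda>x. x) p"
  by (rule cdiffI[where D = "\<lambda>x. x"]) auto

lemma cdiff_Pair:
  assumes "cdiff s (*) f p" "cdiff s (*) g p" shows "cdiff s pscale (\<lambda>x. (f x, g x)) p"
proof -
  obtain D where D: "(f has_derivative D) (at p)" "\<And>c x. D (s c x) = c * D x"
    using assms(1) unfolding cdiff_def by blast
  obtain D' where "(g has_derivative D') (at p)" "\<And>c x. D' (s c x) = c * D' x"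
    using assms(2) unfolding cdiff_def by blast
  with D show ?thesis
    by (intro cdiffI[where D = "\<lambda>x. (D x, D' x)"] has_derivative_Pair) (auto simp: pscale_def)
qed

lemma bounded_linear_axis: "bounded_linear (axis i :: 'a::real_normed_vector \<Rightarrow> 'a ^ 'n::finite)"
  by (rule bounded_linear_intro[where K = 1])
     (auto simp: vec_eq_iff axis_def norm_vec_def L2_set_def if_distrib[of norm] if_distrib[of "\<lambda>x. x\<^sup>2"] cong: if_cong)

lemma has_derivative_vecI:
  fixes f :: "'a::real_normed_vector \<Rightarrow> complex ^ 'n::finite"
  assumes "\<And>i. ((\<lambda>x. f x $ i) has_derivative (\<lambda>h. D h $ i)) (at p)"
  shows "(f has_derivative D) (at p)"
proof -
  have "((\<lambda>x. \<Sum>i\<in>UNIV. axis i (f x $ i)) has_derivative (\<lambda>h. \<Sum>i\<in>UNIV. axis i (D h $ i))) (at p)"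
    by (intro has_derivative_sum bounded_linear.has_derivative[OF bounded_linear_axis] assms)
  moreover have "(\<Sum>i\<in>UNIV. axis i (z $ i)) = z" for z :: "complex ^ 'n"
    by (simp add: vec_eq_iff axis_def)
  ultimately show ?thesis by simp
qed

lemma cdiff_vec:
  fixes f :: "'a::real_normed_vector \<Rightarrow> complex ^ 'n::finite"
  assumes "\<And>i. cdiff s (*) (\<lambda>x. f x $ i) p" shows "cdiff s (*s) f p"
proof -
  from assms have "\<forall>i. \<exists>D. ((\<lambda>x. f x $ i) has_derivative D) (at p) \<and> (\<forall>c x. D (s c x) = c * D x)"
    unfolding cdiff_def by blast
  then obtain D where D: "\<And>i. ((\<lambda>x. f x $ i) has_derivative D i) (at p)"
      "\<And>i c x. D i (s c x) = c * D i x"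
    by metis
  have "(f has_derivative (\<lambda>h. \<chi> i. D i h)) (at p)"
    by (rule has_derivative_vecI) (simp add: D(1))
  thus ?thesis
    by (rule cdiffI) (simp add: D(2) vec_eq_iff)
qed

lemma holomorphic_map_on_iff_cdiff:
  "holomorphic_map_on f U \<longleftrightarrow> open U \<and> (\<forall>z\<in>U. cdiff (*s) (*s) f z)"
proof -
  have "Vector_Spaces.linear (*s) (*s) D \<longleftrightarrow> (\<forall>c x. D (c *s x) = c *s D x)"
    if "(f has_derivative D) (at z)" for D z
  proof
    assume "\<forall>c x. D (c *s x) = c *s D x"
    with that show "Vector_Spaces.linear (*s) (*s) D"
      by (intro Vector_Spaces.linear_iff[THEN iffD2] conjI)
         (auto intro: vec.vector_space_axioms linear_add[OF has_derivative_linear])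
  qed (simp add: Vector_Spaces.linear_iff)
  thus ?thesis unfolding holomorphic_map_on_def cdiff_def by blast
qed

lemma cdiff_transform:
  assumes "cdiff s t f p" "open U" "p \<in> U" "\<And>x. x \<in> U \<Longrightarrow> f x = g x"
  shows "cdiff s t g p"
proof -
  obtain D where D: "(f has_derivative D) (at p)" "\<And>c x. D (s c x) = t c (D x)"
    using assms(1) unfolding cdiff_def by blast
  have "(g has_derivative D) (at p)"
    using D(1) assms(2,3) by (rule has_derivative_transform_within_open) (simp add: assms(4))
  thus ?thesis using D(2) by (rule cdiffI)
qed

section \<open>Cauchy estimates and locally uniform limits in two variables\<close>

lemma norm_pscale: "norm (pscale c h) = cmod c * norm h"
proof -
  have "(cmod c * cmod x)\<^sup>2 + (cmod c * cmod y)\<^sup>2 = (cmod c)\<^sup>2 * ((cmod x)\<^sup>2 + (cmod y)\<^sup>2)" for x y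
    by (simp only: power_mult_distrib distrib_left)
  thus ?thesis
    by (simp add: pscale_def norm_prod_def norm_mult real_sqrt_mult)
qed

text \<open>Restricting to the complex line through \<open>p\<close> in direction \<open>h\<close> reduces this to the one-variable
  Cauchy inequality.\<close>
lemma cauchy_estimate:
  assumes f: "\<And>x. x \<in> cball p r \<Longrightarrow> cdiff pscale (*) f x" and r: "0 < r"
    and B: "\<And>x. x \<in> cball p r \<Longrightarrow> cmod (f x) \<le> B"
    and D: "(f has_derivative D) (at p)"
  shows "cmod (D h) \<le> B / r * norm h"
proof (cases "h = 0")
  case True
  thus ?thesis using has_derivative_linear[OF D] by (simp add: linear_0)
next
  case False
  define \<phi> where "\<phi> = (\<lambda>s. f (p + pscale s h))"
  define R where "R = r / norm h"
  have R: "R > 0" using r False by (simp add: R_def)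
  have line: "((\<lambda>s. p + pscale s h) has_derivative (\<lambda>s. pscale s h)) (at s)" for s
    unfolding pscale_def by (auto intro!: derivative_eq_intros has_derivative_Pair simp: zero_prod_def)
  have cline: "cdiff (*) pscale (\<lambda>s. p + pscale s h) s" for s
    by (rule cdiffI[OF line]) (simp add: pscale_def)
  have in_ball: "p + pscale s h \<in> cball p r" if "s \<in> cball 0 R" for s
    using that False by (simp add: R_def dist_norm norm_pscale field_simps)
  have diff: "\<phi> field_differentiable (at s)" if s: "s \<in> cball 0 R" for s
  proof -
    have "cdiff (*) (*) \<phi> s"
      unfolding \<phi>_def using cline f[OF in_ball[OF s]] by (rule cdiff_comp)
    then obtain D where D: "(\<phi> has_derivative D) (at s)" "\<And>c x. D (c * x) = c * D x"
      unfolding cdiff_def by blast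
    have "D c = D 1 * c" for c
      by (metis D(2) mult.commute mult.right_neutral)
    hence "D = (*) (D 1)" by (rule ext)
    with D(1) have "(\<phi> has_field_derivative D 1) (at s)"
      by (simp only: has_field_derivative_def)
    thus ?thesis
      unfolding field_differentiable_def by blast
  qed
  obtain D' where D': "(f has_derivative D') (at p)" "\<And>c x. D' (pscale c x) = c * D' x"
    using f[of p] r unfolding cdiff_def by auto
  have DD: "D = D'" using D D'(1) by (rule has_derivative_unique)
  have "(\<phi> has_derivative (\<lambda>s. D (pscale s h))) (at 0)"
    unfolding \<phi>_def
    by (rule has_derivative_compose[OF line[of 0], of f D]) (simp add: D pscale_def flip: zero_prod_def)
  moreover have "(\<lambda>s. D (pscale s h)) = (*) (D h)"
    by (rule ext) (simp only: DD D'(2) mult.commute)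
  ultimately have "(\<phi> has_field_derivative D h) (at 0)"
    by (simp only: has_field_derivative_def)
  hence der: "deriv \<phi> 0 = D h" by (rule DERIV_imp_deriv)
  have "cmod ((deriv ^^ 1) \<phi> 0) \<le> fact 1 * B / R ^ 1"
  proof (rule Cauchy_inequality[OF _ _ R])
    show "\<phi> holomorphic_on ball 0 R"
      by (rule holomorphic_onI) (simp add: diff field_differentiable_at_within)
    show "continuous_on (cball 0 R) \<phi>"
      by (rule holomorphic_on_imp_continuous_on, rule holomorphic_onI)
         (simp add: diff field_differentiable_at_within)
    show "cmod (\<phi> x) \<le> B" if "cmod (0 - x) = R" for x
      unfolding \<phi>_def using that by (intro B in_ball) auto
  qed
  thus ?thesis using der by (simp add: R_def)
qed

text \<open>Weierstrass' theorem in two variables. By the Cauchy estimate the derivatives converge uniformly on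
  the ball of half the radius, and a limit of complex-linear maps is complex-linear.\<close>
lemma cdiff_uniform_limit:
  assumes f: "\<And>n x. x \<in> cball p r \<Longrightarrow> cdiff pscale (*) (f n) x" and r: "0 < r"
    and lim: "uniform_limit (cball p r) f g sequentially"
  shows "cdiff pscale (*) g p"
proof -
  have "\<forall>n x. \<exists>D. x \<in> cball p r \<longrightarrow> (f n has_derivative D) (at x) \<and> (\<forall>c h. D (pscale c h) = c * D h)"
    using f unfolding cdiff_def by blast
  then obtain D where D: "\<And>n x. x \<in> cball p r \<Longrightarrow> (f n has_derivative D n x) (at x)"
      "\<And>n x c h. x \<in> cball p r \<Longrightarrow> D n x (pscale c h) = c * D n x h"
    by metis
  define S where "S = ball p (r / 2)"
  have S: "convex S" "open S" "p \<in> S" "S \<subseteq> cball p r" using r by (auto simp: S_def)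
  have bound: "\<exists>N. \<forall>n\<ge>N. \<forall>m\<ge>N. \<forall>x\<in>S. \<forall>h. cmod (D n x h - D m x h) \<le> e * norm h"
    if e: "e > 0" for e
  proof -
    have "e * r / 4 > 0" using e r by simp
    then obtain N where N: "\<And>n x. n \<ge> N \<Longrightarrow> x \<in> cball p r \<Longrightarrow> dist (f n x) (g x) < e * r / 4"
      using lim unfolding uniform_limit_sequentially_iff by blast
    have "cmod (D n x h - D m x h) \<le> e * norm h" if "n \<ge> N" "m \<ge> N" "x \<in> S" for n m x h
    proof -
      have sub: "y \<in> cball p r" if "y \<in> cball x (r / 2)" for y
        using that \<open>x \<in> S\<close> dist_triangle[of p y x] by (simp add: S_def)
      have "cmod (f n y - f m y) \<le> e * r / 2" if "y \<in> cball x (r / 2)" for y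
        using N[OF \<open>n \<ge> N\<close> sub[OF that]] N[OF \<open>m \<ge> N\<close> sub[OF that]]
          dist_triangle[of "f n y" "f m y" "g y"] by (simp add: dist_norm norm_minus_commute)
      moreover have "((\<lambda>y. f n y - f m y) has_derivative (\<lambda>h. D n x h - D m x h)) (at x)"
        using \<open>x \<in> S\<close> S by (intro has_derivative_diff D) auto
      ultimately have "cmod (D n x h - D m x h) \<le> (e * r / 2) / (r / 2) * norm h"
        using r by (intro cauchy_estimate[of x "r / 2" "\<lambda>y. f n y - f m y"] cdiff_diff f sub) auto
      thus ?thesis using r by simp
    qed
    thus ?thesis by blast
  qed
  define D' where "D' = (\<lambda>x h. lim (\<lambda>n. D n x h))"
  have D': "(\<lambda>n. D n x h) \<longlonglongrightarrow> D' x h" if x: "x \<in> S" for x h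
  proof -
    have "Cauchy (\<lambda>n. D n x h)"
    proof (rule CauchyI)
      fix e :: real assume "e > 0"
      hence "e / (norm h + 1) > 0" by (simp add: add_nonneg_pos)
      from bound[OF this] obtain N where
        N: "\<And>n m. n \<ge> N \<Longrightarrow> m \<ge> N \<Longrightarrow> cmod (D n x h - D m x h) \<le> e / (norm h + 1) * norm h"
        using x by blast
      have "e / (norm h + 1) * norm h < e"
        using \<open>e > 0\<close> mult_pos_pos[of e 1] by (simp add: divide_less_eq add_nonneg_pos distrib_left)
      thus "\<exists>M. \<forall>m\<ge>M. \<forall>n\<ge>M. norm (D m x h - D n x h) < e"
        using N by (meson order_le_less_trans)
    qed
    thus ?thesis unfolding D'_def by (simp add: Cauchy_convergent_iff convergent_LIMSEQ_iff)
  qed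
  have unif: "\<forall>\<^sub>F n in sequentially. \<forall>x\<in>S. \<forall>h. cmod (D n x h - D' x h) \<le> e * norm h" if e: "e > 0" for e
  proof -
    obtain N where N: "\<And>n m x h. n \<ge> N \<Longrightarrow> m \<ge> N \<Longrightarrow> x \<in> S \<Longrightarrow> cmod (D n x h - D m x h) \<le> e * norm h"
      using bound[OF e] by blast
    have "cmod (D n x h - D' x h) \<le> e * norm h" if "n \<ge> N" "x \<in> S" for n x h
    proof (rule tendsto_upperbound)
      show "(\<lambda>m. cmod (D n x h - D m x h)) \<longlonglongrightarrow> cmod (D n x h - D' x h)"
        by (intro tendsto_intros D' that)
      show "\<forall>\<^sub>F m in sequentially. cmod (D n x h - D m x h) \<le> e * norm h"
        unfolding eventually_sequentially using N[OF that(1) _ that(2)] by blast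
    qed auto
    thus ?thesis unfolding eventually_sequentially by blast
  qed
  have glim: "(\<lambda>n. f n x) \<longlonglongrightarrow> g x" if "x \<in> S" for x
    using tendsto_uniform_limitI[OF lim] S that by blast
  have "\<exists>g2. \<forall>x\<in>S. (\<lambda>n. f n x) \<longlonglongrightarrow> g2 x \<and> (g2 has_derivative D' x) (at x within S)"
  proof (rule has_derivative_sequence[where ?x0.0 = p and l = "g p", OF S(1)])
    show "(f n has_derivative D n x) (at x within S)" if "x \<in> S" for n x
      by (rule has_derivative_at_withinI, rule D(1)) (use that S in blast)
  qed (use unif S(3) glim[OF S(3)] in auto)
  then obtain g2 where g2: "\<And>x. x \<in> S \<Longrightarrow> (\<lambda>n. f n x) \<longlonglongrightarrow> g2 x"
      "\<And>x. x \<in> S \<Longrightarrow> (g2 has_derivative D' x) (at x within S)"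
    by blast
  have "g2 x = g x" if "x \<in> S" for x
    using LIMSEQ_unique g2(1) glim that by blast
  moreover have "(g2 has_derivative D' p) (at p)"
    using g2(2)[OF S(3)] by (simp only: at_within_open[OF S(3,2)])
  ultimately have "(g has_derivative D' p) (at p)"
    using S(2,3) by (metis has_derivative_transform_within_open)
  moreover have "D' p (pscale c h) = c * D' p h" for c h
  proof (rule LIMSEQ_unique[OF D'[OF S(3)]])
    show "(\<lambda>n. D n p (pscale c h)) \<longlonglongrightarrow> c * D' p h"
      using D(2)[of p] r by (auto intro!: tendsto_intros D' S)
  qed
  ultimately show ?thesis by (rule cdiffI)
qed

section \<open>An automorphism of the plane\<close>

text \<open>The multiplier of the overshears below. What matters is that it is entire without zeros and agrees
  with $1 + z$ to second order: a nonzero quadratic term would put a multiple of $\log n$ into the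
  asymptotics of $1 / v_n$.\<close>
definition factor :: "complex \<Rightarrow> complex" where "factor z = exp (z - z\<^sup>2 / 2)"

text \<open>With $V = v E(u)$ one has $1 / v = E(u) / V$ and $1 / v' = E(u + V) / V$, where $E$ is \<open>factor\<close>: the
  increment of $1 / v$ is a difference quotient of $E$, which is close to $E'(0) = 1$.\<close>
definition base_snd :: "complex \<Rightarrow> complex \<Rightarrow> complex" where
  "base_snd u v = v * factor u / factor (u + v * factor u)"

text \<open>Subtracting $v' + v'^2$ reduces $u + V$ to $u + u v$ up to terms of third order; a surviving
  multiple of $v^2$ would make $u / v$ grow logarithmically. The factor $e^{- 2 v'}$ makes $u$ decay at
  the same rate as $v$, so that $u / v$ has a limit.\<close>
definition base_fst :: "complex \<Rightarrow> complex \<Rightarrow> complex" where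
  "base_fst u v = (u + v * factor u - base_snd u v - (base_snd u v)\<^sup>2) * exp (- 2 * base_snd u v)"

text \<open>The composition of the overshear $(u, v) \mapsto (u, v E(u))$, the overshear
  $V \mapsto V / E(u + V)$ along the lines where $u + V$ is constant, the shear
  $u \mapsto u - v'^2$ and the overshear $u \mapsto u e^{- 2 v'}$. Each is an automorphism.\<close>
definition base_map :: "complex \<times> complex \<Rightarrow> complex \<times> complex" where
  "base_map p = (base_fst (fst p) (snd p), base_snd (fst p) (snd p))"

definition base_inv :: "complex \<times> complex \<Rightarrow> complex \<times> complex" where
  "base_inv q = (let w = fst q * exp (2 * snd q) + (snd q)\<^sup>2 + snd q; V = snd q * factor w; u = w - V
     in (u, V / factor u))"

lemma factor_nonzero [simp]: "factor z \<noteq> 0"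
  by (simp add: factor_def)

lemma factor_0 [simp]: "factor 0 = 1"
  by (simp add: factor_def)

lemma base_inv_base: "base_inv (base_map p) = p"
proof (cases p)
  case (Pair u v)
  have "exp (- (2 * x)) * exp (2 * x) = 1" for x :: complex
    by (simp flip: exp_add)
  hence "base_fst u v * exp (2 * base_snd u v) + (base_snd u v)\<^sup>2 + base_snd u v = u + v * factor u"
    by (simp add: base_fst_def mult.assoc)
  moreover have "base_snd u v * factor (u + v * factor u) = v * factor u"
    by (simp add: base_snd_def)
  ultimately show ?thesis
    by (simp add: Pair base_map_def base_inv_def Let_def)
qed

lemma base_base_inv: "base_map (base_inv q) = q"
proof (cases q)
  case (Pair a b)
  define w where "w = a * exp (2 * b) + b\<^sup>2 + b"
  define u where "u = w - b * factor w"
  define v where "v = b * factor w / factor u"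
  have inv: "base_inv q = (u, v)"
    by (simp add: Pair base_inv_def Let_def u_def v_def w_def)
  have w: "u + v * factor u = w" by (simp add: v_def u_def)
  have b: "base_snd u v = b"
    unfolding base_snd_def w by (simp add: v_def)
  have "exp (2 * x) * exp (- (2 * x)) = 1" for x :: complex
    by (simp flip: exp_add)
  hence "base_fst u v = a"
    unfolding base_fst_def w b by (simp add: w_def mult.assoc)
  thus ?thesis unfolding inv base_map_def by (simp add: b Pair)
qed

lemma cdiff_factor: "cdiff s (*) f p \<Longrightarrow> cdiff s (*) (\<lambda>x. factor (f x)) p"
  unfolding factor_def by (intro cdiff_exp cdiff_diff cdiff_divide cdiff_power cdiff_const) auto

lemma cdiff_base_snd:
  assumes "cdiff s (*) f p" "cdiff s (*) g p" shows "cdiff s (*) (\<lambda>x. base_snd (f x) (g x)) p"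
  unfolding base_snd_def by (intro cdiff_divide cdiff_mult cdiff_factor cdiff_add assms) auto

lemma cdiff_base_fst:
  assumes "cdiff s (*) f p" "cdiff s (*) g p" shows "cdiff s (*) (\<lambda>x. base_fst (f x) (g x)) p"
  unfolding base_fst_def
  by (intro cdiff_mult cdiff_diff cdiff_add cdiff_power cdiff_exp cdiff_const cdiff_factor cdiff_base_snd assms)

lemma cdiff_base: "cdiff pscale pscale base_map p"
  unfolding base_map_def by (intro cdiff_Pair cdiff_base_fst cdiff_base_snd cdiff_fst cdiff_snd)

lemma cdiff_base_inv: "cdiff pscale pscale base_inv p"
  unfolding base_inv_def Let_def
  by (intro cdiff_Pair cdiff_diff cdiff_add cdiff_mult cdiff_divide cdiff_power cdiff_exp cdiff_const
        cdiff_factor cdiff_fst cdiff_snd factor_nonzero)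

lemma exp_taylor1:
  assumes "cmod w \<le> 1" shows "cmod (exp w - 1 - w) \<le> 3 * (cmod w)\<^sup>2"
proof -
  have "cmod (exp w - (\<Sum>k\<le>1. w ^ k / fact k)) \<le> exp \<bar>Re w\<bar> * (cmod w) ^ Suc 1 / fact 1"
    by (rule Taylor_exp)
  moreover have "exp \<bar>Re w\<bar> \<le> 3"
    using exp_le abs_Re_le_cmod[of w] assms by (meson exp_le_cancel_iff order_trans)
  ultimately show ?thesis
    using mult_right_mono[of "exp \<bar>Re w\<bar>" 3 "(cmod w)\<^sup>2"]
    by (simp add: power2_eq_square algebra_simps)
qed

lemma factor_taylor:
  assumes z: "cmod z \<le> 1 / 2" shows "cmod (factor z - 1 - z) \<le> 6 * (cmod z)\<^sup>2"
proof -
  define w where "w = z - z\<^sup>2 / 2"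
  have "(cmod z)\<^sup>2 \<le> 1 / 2 * cmod z"
    unfolding power2_eq_square using z by (intro mult_right_mono) auto
  hence w: "cmod w \<le> 5 / 4 * cmod z"
    unfolding w_def using norm_triangle_ineq4[of z "z\<^sup>2 / 2"] by (simp add: norm_power norm_divide)
  have eq: "factor z - 1 - z = (exp w - 1 - w) - z\<^sup>2 / 2"
    by (simp add: factor_def w_def)
  have "cmod (factor z - 1 - z) \<le> cmod (exp w - 1 - w) + (cmod z)\<^sup>2 / 2"
    unfolding eq using norm_triangle_ineq4[of "exp w - 1 - w" "z\<^sup>2 / 2"]
    by (simp add: norm_power norm_divide)
  also have "cmod (exp w - 1 - w) \<le> 3 * (cmod w)\<^sup>2"
    using w z by (intro exp_taylor1) auto
  also have "(cmod w)\<^sup>2 \<le> (5 / 4 * cmod z)\<^sup>2"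
    using w by (intro power_mono) auto
  also have "3 * (5 / 4 * cmod z)\<^sup>2 + (cmod z)\<^sup>2 / 2 = 83 / 16 * (cmod z)\<^sup>2"
    by (simp add: power_mult_distrib power_divide)
  also have "\<dots> \<le> 6 * (cmod z)\<^sup>2"
    by (intro mult_right_mono) auto
  finally show ?thesis by simp
qed

text \<open>The derivative of the remainder is $(1 - z) E(z) - 1$, which vanishes to second order at $0$.\<close>
lemma factor_remainder_lipschitz:
  assumes a: "cmod a \<le> \<rho>" and b: "cmod b \<le> \<rho>" and \<rho>: "\<rho> \<le> 1 / 2"
  shows "cmod ((factor a - 1 - a) - (factor b - 1 - b)) \<le> 10 * \<rho>\<^sup>2 * cmod (a - b)"
proof (rule field_differentiable_bound[OF convex_cball[of 0 \<rho>]])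
  fix z assume "z \<in> cball (0::complex) \<rho>"
  hence z: "cmod z \<le> \<rho>" by simp
  show "((\<lambda>z. factor z - 1 - z) has_field_derivative ((1 - z) * factor z - 1)) (at z within cball 0 \<rho>)"
    unfolding factor_def by (auto intro!: derivative_eq_intros simp: algebra_simps)
  have "(1 - z) * factor z - 1 = (1 - z) * (factor z - 1 - z) - z\<^sup>2"
    by (simp add: algebra_simps power2_eq_square)
  hence "cmod ((1 - z) * factor z - 1) \<le> cmod (1 - z) * cmod (factor z - 1 - z) + (cmod z)\<^sup>2"
    using norm_triangle_ineq4[of "(1 - z) * (factor z - 1 - z)" "z\<^sup>2"] by (simp add: norm_mult norm_power)
  also have "cmod (1 - z) * cmod (factor z - 1 - z) \<le> (3 / 2) * (6 * (cmod z)\<^sup>2)"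
    using z \<rho> norm_triangle_ineq4[of 1 z] by (intro mult_mono factor_taylor) auto
  also have "(3 / 2) * (6 * (cmod z)\<^sup>2) + (cmod z)\<^sup>2 = 10 * (cmod z)\<^sup>2" by simp
  also have "\<dots> \<le> 10 * \<rho>\<^sup>2"
    using z by (intro mult_left_mono power_mono) auto
  finally show "cmod ((1 - z) * factor z - 1) \<le> 10 * \<rho>\<^sup>2" by simp
qed (use a b in auto)

section \<open>Asymptotics near the origin\<close>

text \<open>The bound on $u'/v' - u/v$ is proportional to $1 + |u / v|$ and not to a constant: it must be
  applicable to an orbit that converges to the origin before anything is known about $u / v$.\<close>
lemma base_asymptotics:
  fixes u v :: complex
  assumes u: "cmod u \<le> 1 / 16" and v: "cmod v \<le> 1 / 16" and v0: "v \<noteq> 0"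
  defines "u' \<equiv> base_fst u v" and "v' \<equiv> base_snd u v"
  shows "v' \<noteq> 0"
    and "cmod (1 / v' - 1 / v - 1) \<le> 80 * ((cmod u)\<^sup>2 + (cmod v)\<^sup>2)" (is "?U")
    and "cmod (u' / v' - u / v) \<le> 300 * (1 + cmod (u / v)) * ((cmod v)\<^sup>2 + cmod v * (cmod u)\<^sup>2)" (is "?T")
proof -
  define a b where "a = cmod u" and "b = cmod v"
  have ab: "0 \<le> a" "a \<le> 1 / 16" "0 < b" "b \<le> 1 / 16"
    using u v v0 by (auto simp: a_def b_def)
  define V where "V = v * factor u"
  define R where "R = factor u - 1 - u"
  have V0: "V \<noteq> 0" using v0 by (simp add: V_def)
  show v'0: "v' \<noteq> 0" using v0 by (simp add: v'_def base_snd_def)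
  have a2: "a\<^sup>2 \<le> 1 / 16 * a" and b2: "b\<^sup>2 \<le> 1 / 16 * b"
    unfolding power2_eq_square
    using mult_right_mono[OF ab(2) ab(1)] mult_right_mono[OF ab(4), of b] ab by auto
  have "cmod R \<le> 6 * a\<^sup>2"
    unfolding R_def a_def using u by (intro factor_taylor) auto
  moreover have "cmod (factor u) \<le> 1 + a + cmod R"
    using norm_triangle_ineq[of "1 + u" R] norm_triangle_ineq[of 1 u] by (simp add: R_def a_def)
  ultimately have "cmod (factor u) \<le> 2" using a2 ab by simp
  hence Vb: "cmod V \<le> 2 * b"
    unfolding V_def norm_mult b_def[symmetric] using ab by (simp add: mult.commute)
  define \<epsilon> where "\<epsilon> = 1 / v' - 1 / v - 1"
  have rem: "\<epsilon> = ((factor (u + V) - 1 - (u + V)) - (factor u - 1 - u)) / V"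
  proof -
    have "1 / v' = factor (u + V) / V" by (simp add: v'_def base_snd_def V_def)
    moreover have "1 / v = factor u / V" by (simp add: V_def)
    ultimately show ?thesis using V0 by (simp add: \<epsilon>_def field_simps)
  qed
  have "cmod ((factor (u + V) - 1 - (u + V)) - (factor u - 1 - u)) \<le> 10 * (a + 2 * b)\<^sup>2 * cmod (u + V - u)"
    using norm_triangle_ineq[of u V] Vb ab by (intro factor_remainder_lipschitz) (auto simp: a_def)
  hence "cmod \<epsilon> \<le> 10 * (a + 2 * b)\<^sup>2"
    unfolding rem using V0 by (simp add: norm_divide divide_le_eq)
  also have "\<dots> \<le> 80 * (a\<^sup>2 + b\<^sup>2)"
  proof -
    have "80 * (a\<^sup>2 + b\<^sup>2) - 10 * (a + 2 * b)\<^sup>2 = 20 * (a - b)\<^sup>2 + 50 * a\<^sup>2 + 20 * b\<^sup>2"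
      by (simp add: power2_eq_square algebra_simps)
    thus ?thesis using zero_le_power2[of "a - b"] zero_le_power2[of a] zero_le_power2[of b] by linarith
  qed
  finally have eps: "cmod \<epsilon> \<le> 80 * (a\<^sup>2 + b\<^sup>2)" .
  thus ?U by (simp add: \<epsilon>_def a_def b_def)
  have eps1: "cmod \<epsilon> \<le> 5 / 8" using eps a2 b2 ab by simp
  \<comment> \<open>so that $v' = v / D$; the other quantities are expanded in $v$ and $\<epsilon>$\<close>
  define D where "D = 1 + v + v * \<epsilon>"
  have "cmod (v * (1 + \<epsilon>)) \<le> 1 / 16 * (1 + 5 / 8)"
    unfolding norm_mult using v norm_triangle_ineq[of 1 \<epsilon>] eps1 by (intro mult_mono) auto
  moreover have "D = 1 + v * (1 + \<epsilon>)" by (simp add: D_def algebra_simps)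
  ultimately have Db: "cmod D \<le> 2" "cmod D \<ge> 5 / 6"
    using norm_triangle_ineq[of 1 "v * (1 + \<epsilon>)"] norm_triangle_ineq2[of 1 "- (v * (1 + \<epsilon>))"] by auto
  hence D0: "D \<noteq> 0" by auto
  have "1 / v' = D / v" using v0 by (simp add: \<epsilon>_def D_def field_simps)
  hence v': "v' = v / D" using v0 v'0 D0 by (simp add: field_simps)
  have v'b: "cmod v' \<le> 6 / 5 * b"
  proof -
    have "b / cmod D \<le> b / (5 / 6)" using Db ab by (intro divide_left_mono) auto
    thus ?thesis by (simp add: v' norm_divide b_def)
  qed
  define m where "m = exp (- 2 * v')"
  define \<nu> where "\<nu> = m - 1 + 2 * v'"
  have "cmod \<nu> \<le> 3 * (cmod (- 2 * v'))\<^sup>2"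
    using exp_taylor1[of "- 2 * v'"] v'b ab by (simp add: \<nu>_def m_def norm_mult)
  also have "\<dots> \<le> 3 * (2 * (6 / 5 * b))\<^sup>2"
    using v'b by (intro mult_left_mono power_mono) (auto simp: norm_mult)
  also have "\<dots> \<le> 18 * b\<^sup>2"
    by (simp add: power2_eq_square)
  finally have nu: "cmod \<nu> \<le> 18 * b\<^sup>2" .
  have mb: "cmod m \<le> 2"
  proof -
    have "m = 1 - 2 * v' + \<nu>" by (simp add: \<nu>_def)
    hence "cmod m \<le> 1 + 2 * cmod v' + cmod \<nu>"
      using norm_triangle_ineq[of "1 - 2 * v'" \<nu>] norm_triangle_ineq4[of 1 "2 * v'"] by (simp add: norm_mult)
    thus ?thesis using v'b nu b2 ab by simp
  qed
  \<comment> \<open>\<open>m * X\<close> is the part of $u'/v' - u/v$ without the factor $u/v$, and \<open>Y\<close> the coefficient of $u/v$\<close>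
  define X where "X = D * R + v * v' * (1 + \<epsilon>) + v * \<epsilon>"
  define Y where "Y = (1 + v) * D * m - 1"
  have main: "u' / v' - u / v = u / v * Y + m * X"
  proof -
    have u': "u' = (u + V - v' - v'\<^sup>2) * m"
      by (simp add: u'_def base_fst_def V_def m_def flip: v'_def)
    have V: "V = v + u * v + v * R" by (simp add: V_def R_def algebra_simps)
    have vv: "v * v' * (1 + \<epsilon>) = v - v'"
    proof -
      have "v' * D = v" using D0 by (simp add: v')
      thus ?thesis by (simp add: D_def algebra_simps)
    qed
    have "u' / v' = (u + V - v' - v'\<^sup>2) / v' * m" by (simp add: u')
    also have "(u + V - v' - v'\<^sup>2) / v' = (u + V) * (D / v) - 1 - v'"
      using v0 v'0 D0 by (simp add: v' field_simps power2_eq_square)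
    also have "(u + V) * (D / v) = u / v * ((1 + v) * D) + D + D * R"
      using v0 by (simp add: V field_simps)
    also have "u / v * ((1 + v) * D) + D + D * R - 1 - v' = u / v * ((1 + v) * D) + X"
      by (simp add: X_def vv) (simp add: D_def)
    finally show ?thesis by (simp add: Y_def algebra_simps)
  qed
  have Rb: "cmod R \<le> 10 * a\<^sup>2 * a"
    using factor_remainder_lipschitz[of u a 0] ab by (simp add: R_def a_def)
  have veps: "b * cmod \<epsilon> \<le> 80 * (b * a\<^sup>2) + 5 * b\<^sup>2"
  proof -
    have "b * cmod \<epsilon> \<le> b * (80 * (a\<^sup>2 + b\<^sup>2))" using eps ab by (intro mult_left_mono) auto
    also have "\<dots> = 80 * (b * a\<^sup>2) + 80 * b * b\<^sup>2" by (simp add: algebra_simps)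
    also have "80 * b * b\<^sup>2 \<le> 5 * b\<^sup>2" using ab by (intro mult_right_mono) auto
    finally show ?thesis by simp
  qed
  have Xb: "cmod X \<le> 20 * a\<^sup>2 * a + 7 * b\<^sup>2 + 80 * (b * a\<^sup>2)"
  proof -
    have "cmod X \<le> cmod D * cmod R + cmod v * cmod v' * cmod (1 + \<epsilon>) + cmod v * cmod \<epsilon>"
      unfolding X_def norm_mult[symmetric] by (intro norm_triangle_mono) auto
    also have "cmod D * cmod R \<le> 2 * (10 * a\<^sup>2 * a)"
      using Db Rb by (intro mult_mono) auto
    also have "cmod v * cmod v' * cmod (1 + \<epsilon>) \<le> b * (6 / 5 * b) * (1 + 5 / 8)"
      using v'b eps1 norm_triangle_ineq[of 1 \<epsilon>] ab by (intro mult_mono) (auto simp: b_def)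
    also have "cmod v * cmod \<epsilon> \<le> 80 * (b * a\<^sup>2) + 5 * b\<^sup>2" using veps by (simp add: b_def)
    finally have "cmod X \<le> 20 * a\<^sup>2 * a + 139 / 20 * b\<^sup>2 + 80 * (b * a\<^sup>2)"
      by (simp add: power2_eq_square)
    thus ?thesis using zero_le_power2[of b] by linarith
  qed
  have Yb: "cmod Y \<le> 60 * b\<^sup>2 + 180 * (b * a\<^sup>2)"
  proof -
    define \<kappa> where "\<kappa> = v\<^sup>2 + v * \<epsilon> * (1 + v)"
    define \<mu> where "\<mu> = 2 * (v * v' * (1 + \<epsilon>)) + \<nu>"
    have "v' * D = v" using D0 by (simp add: v')
    hence vv: "v * v' * (1 + \<epsilon>) = v - v'" by (simp add: D_def algebra_simps)
    have m: "m = 1 - 2 * v + \<mu>"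
      unfolding \<mu>_def vv by (simp add: \<nu>_def)
    have "(1 + v) * D = 1 + 2 * v + \<kappa>"
      by (simp add: D_def \<kappa>_def algebra_simps power2_eq_square)
    hence "Y = (1 + 2 * v) * (1 - 2 * v + \<mu>) + \<kappa> * m - 1"
      by (simp add: Y_def m algebra_simps)
    hence "Y = - 4 * v\<^sup>2 + (1 + 2 * v) * \<mu> + \<kappa> * m"
      by (simp add: algebra_simps power2_eq_square)
    hence "cmod Y \<le> cmod (- 4 * v\<^sup>2) + cmod ((1 + 2 * v) * \<mu>) + cmod (\<kappa> * m)"
      by (simp only:) (intro norm_triangle_mono order.refl)
    also have "cmod (- 4 * v\<^sup>2) = 4 * b\<^sup>2" by (simp add: norm_mult norm_power b_def)
    also have "cmod ((1 + 2 * v) * \<mu>) \<le> (9 / 8) * (22 * b\<^sup>2)"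
    proof -
      have "cmod \<mu> \<le> cmod (2 * (v * v' * (1 + \<epsilon>))) + cmod \<nu>" unfolding \<mu>_def by (rule norm_triangle_ineq)
      also have "cmod (2 * (v * v' * (1 + \<epsilon>))) \<le> 2 * (b * (6 / 5 * b) * (1 + 5 / 8))"
        unfolding norm_mult
        using v'b eps1 norm_triangle_ineq[of 1 \<epsilon>] ab by (intro mult_mono) (auto simp: b_def)
      also have "2 * (b * (6 / 5 * b) * (1 + 5 / 8)) = 39 / 10 * b\<^sup>2" by (simp add: power2_eq_square)
      finally have "cmod \<mu> \<le> 22 * b\<^sup>2" using nu zero_le_power2[of b] by linarith
      moreover have "cmod (1 + 2 * v) \<le> 9 / 8"
        using norm_triangle_ineq[of 1 "2 * v"] v by (simp add: norm_mult)
      ultimately show ?thesis unfolding norm_mult by (intro mult_mono) auto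
    qed
    also have "cmod (\<kappa> * m) \<le> (b\<^sup>2 + (80 * (b * a\<^sup>2) + 5 * b\<^sup>2) * (17 / 16)) * 2"
    proof -
      have "cmod \<kappa> \<le> b\<^sup>2 + (b * cmod \<epsilon>) * cmod (1 + v)"
        unfolding \<kappa>_def b_def norm_mult[symmetric] norm_power[symmetric] by (rule norm_triangle_ineq)
      also have "(b * cmod \<epsilon>) * cmod (1 + v) \<le> (80 * (b * a\<^sup>2) + 5 * b\<^sup>2) * (17 / 16)"
        using veps norm_triangle_ineq[of 1 v] v ab by (intro mult_mono) auto
      finally show ?thesis unfolding norm_mult using mb ab by (intro mult_mono) auto
    qed
    finally have "cmod Y \<le> 331 / 8 * b\<^sup>2 + 170 * (b * a\<^sup>2)"
      by (simp add: algebra_simps)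
    moreover have "0 \<le> b * a\<^sup>2" using ab by simp
    ultimately show ?thesis using zero_le_power2[of b] by linarith
  qed
  define t where "t = cmod (u / v)"
  have a_eq: "a = t * b" using v0 by (simp add: a_def b_def t_def norm_divide)
  have t0: "t \<ge> 0" by (simp add: t_def)
  have "cmod (u' / v' - u / v) \<le> t * cmod Y + cmod m * cmod X"
    unfolding main t_def norm_mult[symmetric] by (rule norm_triangle_ineq)
  also have "\<dots> \<le> t * (60 * b\<^sup>2 + 180 * (b * a\<^sup>2)) + 2 * (20 * a\<^sup>2 * a + 7 * b\<^sup>2 + 80 * (b * a\<^sup>2))"
    using Yb Xb mb t0 by (intro add_mono mult_mono) auto
  also have "20 * a\<^sup>2 * a = 20 * (t * (b * a\<^sup>2))" by (subst (2) a_eq) simp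
  also have "t * (60 * b\<^sup>2 + 180 * (b * a\<^sup>2)) + 2 * (20 * (t * (b * a\<^sup>2)) + 7 * b\<^sup>2 + 80 * (b * a\<^sup>2)) =
      60 * (t * b\<^sup>2) + 220 * (t * (b * a\<^sup>2)) + 14 * b\<^sup>2 + 160 * (b * a\<^sup>2)"
    by (simp add: algebra_simps)
  also have "\<dots> \<le> 300 * (t * b\<^sup>2) + 300 * (t * (b * a\<^sup>2)) + 300 * b\<^sup>2 + 300 * (b * a\<^sup>2)"
    using t0 ab by (intro add_mono mult_right_mono) auto
  also have "\<dots> = 300 * (1 + t) * (b\<^sup>2 + b * a\<^sup>2)" by (simp add: algebra_simps)
  finally show ?T by (simp add: t_def a_def b_def)
qed

section \<open>Petals and the basin of the planar map\<close>

definition U_coord :: "complex \<times> complex \<Rightarrow> complex" where "U_coord p = 1 / snd p"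
definition t_coord :: "complex \<times> complex \<Rightarrow> complex" where "t_coord p = fst p / snd p"

definition base_basin :: "(complex \<times> complex) set" where
  "base_basin = {p. snd p \<noteq> 0 \<and> (\<lambda>n. (base_map ^^ n) p) \<longlonglongrightarrow> 0}"

text \<open>Divided by $(\mathrm{Re}\, U)^2$, it bounds the deviation of one step from
  $(U, t) \mapsto (U + 1, t)$ where $|t| \le M$ and $\mathrm{Re}\, U$ is large.\<close>
definition step_const :: "real \<Rightarrow> real" where
  "step_const M = 300 * (1 + M) * (1 + M\<^sup>2)"

text \<open>Large enough for the deviations accumulated along an orbit that starts in the petal to have sum at
  most $1/16$.\<close>
definition petal_radius :: "real \<Rightarrow> real" where
  "petal_radius M = 64 * step_const (M + 1)"

definition petal :: "real \<Rightarrow> (complex \<times> complex) set" where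
  "petal M = {p. Re (U_coord p) > petal_radius M \<and> cmod (t_coord p) < M}"

lemma snd_base_eq_0_iff [simp]: "snd (base_map p) = 0 \<longleftrightarrow> snd p = 0"
  by (simp add: base_map_def base_snd_def)

lemma snd_base_pow_eq_0_iff [simp]: "snd ((base_map ^^ n) p) = 0 \<longleftrightarrow> snd p = 0"
  by (induction n) auto

lemma norm_le_inverse_Re:
  assumes "Re (1 / v) \<ge> \<rho>" "\<rho> > 0" shows "cmod v \<le> 1 / \<rho>"
proof -
  have "\<rho> \<le> cmod (1 / v)" using assms(1) complex_Re_le_cmod[of "1 / v"] by simp
  moreover have "v \<noteq> 0" using assms by auto
  ultimately show ?thesis using assms(2) by (simp add: norm_divide field_simps)
qed

text \<open>Since \<open>\<rho>\<close> grows linearly, $\rho^{-2}$ is summable along the orbit; dominating it by differences of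
  $4 / \rho$ turns sums of errors into telescoping ones.\<close>
lemma inverse_square_le_telescope:
  fixes \<rho> \<rho>' :: real
  assumes "\<rho> \<ge> 3 / 2" "\<rho> + 1 / 2 \<le> \<rho>'" "\<rho>' \<le> \<rho> + 3 / 2"
  shows "1 / \<rho>\<^sup>2 \<le> 4 / \<rho> - 4 / \<rho>'"
proof -
  have "1 / \<rho>\<^sup>2 \<le> 2 / (\<rho> * \<rho>')"
    using assms mult_left_mono[of \<rho>' "2 * \<rho>" \<rho>] by (simp add: field_simps power2_eq_square)
  also have "\<dots> \<le> 4 * (\<rho>' - \<rho>) / (\<rho> * \<rho>')"
    using assms by (intro divide_right_mono) auto
  also have "\<dots> = 4 / \<rho> - 4 / \<rho>'"
    using assms by (simp add: field_simps)
  finally show ?thesis .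
qed

lemma telescope_norm_bound:
  fixes x :: "nat \<Rightarrow> 'a::real_normed_vector"
  assumes "\<And>n. norm (x (Suc n) - x n) \<le> y n - y (Suc n)" "n \<le> m"
  shows "norm (x m - x n) \<le> y n - y m"
  using assms(2)
proof (induction rule: dec_induct)
  case (step k)
  thus ?case using assms(1)[of k] norm_triangle_ineq[of "x (Suc k) - x k" "x k - x n"] by simp
qed auto

lemma step_const_ge: "M \<ge> 0 \<Longrightarrow> step_const M \<ge> 300 * (1 + M)"
  unfolding step_const_def using mult_left_mono[of 1 "1 + M\<^sup>2" "300 * (1 + M)"] by simp

text \<open>The error estimates are stated as differences of $4 c / \rho$, so that they can be summed along an
  orbit without reference to the growth of $\rho$.\<close>
lemma petal_step:
  assumes \<rho>: "\<rho> = Re (U_coord p)" and t: "cmod (t_coord p) \<le> M"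
    and M: "M \<ge> 0" and large: "\<rho> \<ge> 2 * step_const M"
  defines "\<rho>' \<equiv> Re (U_coord (base_map p))"
  shows "\<rho> + 1 / 2 \<le> \<rho>'" "\<rho>' \<le> \<rho> + 3 / 2"
    and "cmod (U_coord (base_map p) - U_coord p - 1) \<le> 4 * step_const M / \<rho> - 4 * step_const M / \<rho>'"
    and "cmod (t_coord (base_map p) - t_coord p) \<le> 4 * step_const M / \<rho> - 4 * step_const M / \<rho>'"
proof -
  define u v where "u = fst p" and "v = snd p"
  define c where "c = step_const M"
  have c: "c \<ge> 300 * (1 + M)" unfolding c_def using M by (rule step_const_ge)
  have \<rho>_ge: "\<rho> \<ge> 600 * (1 + M)" using large c by (simp add: c_def)
  have \<rho>_pos: "\<rho> \<ge> 600" using \<rho>_ge M by simp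
  have v: "cmod v \<le> 1 / \<rho>"
    using \<rho> \<rho>_pos by (intro norm_le_inverse_Re) (auto simp: U_coord_def v_def)
  have v0: "v \<noteq> 0" using \<rho> \<rho>_pos by (auto simp: U_coord_def v_def)
  have "cmod u = cmod (t_coord p) * cmod v"
    using v0 by (simp add: t_coord_def norm_divide flip: u_def v_def)
  also have "\<dots> \<le> M * (1 / \<rho>)" using t v M by (intro mult_mono) auto
  finally have u: "cmod u \<le> M / \<rho>" by simp
  have "1 / \<rho> \<le> 1 / 16" "M / \<rho> \<le> 1 / 16" using \<rho>_ge M by (auto simp: field_simps)
  with u v have uv16: "cmod u \<le> 1 / 16" "cmod v \<le> 1 / 16" by linarith+
  have u2: "(cmod u)\<^sup>2 \<le> M\<^sup>2 / \<rho>\<^sup>2" using power_mono[OF u, of 2] by (simp add: power_divide)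
  have v2: "(cmod v)\<^sup>2 \<le> 1 / \<rho>\<^sup>2" using power_mono[OF v, of 2] by (simp add: power_divide)
  note asy = base_asymptotics[OF uv16 v0]
  have coords: "U_coord (base_map p) = 1 / base_snd u v" "t_coord (base_map p) = base_fst u v / base_snd u v"
      "U_coord p = 1 / v" "t_coord p = u / v"
    by (auto simp: U_coord_def t_coord_def base_map_def u_def v_def)
  have "cmod (U_coord (base_map p) - U_coord p - 1) \<le> 80 * ((cmod u)\<^sup>2 + (cmod v)\<^sup>2)"
    using asy(2) by (simp add: coords)
  also have "\<dots> \<le> 80 * (M\<^sup>2 / \<rho>\<^sup>2 + 1 / \<rho>\<^sup>2)" using u2 v2 by simp
  also have "\<dots> = 80 * (1 + M\<^sup>2) / \<rho>\<^sup>2" by (simp add: add_divide_distrib distrib_left)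
  also have "\<dots> \<le> c / \<rho>\<^sup>2"
  proof (intro divide_right_mono)
    have "80 * 1 * (1 + M\<^sup>2) \<le> 300 * (1 + M) * (1 + M\<^sup>2)"
      using M by (intro mult_mono) auto
    thus "80 * (1 + M\<^sup>2) \<le> c" by (simp add: c_def step_const_def)
  qed simp
  finally have U: "cmod (U_coord (base_map p) - U_coord p - 1) \<le> c / \<rho>\<^sup>2" .
  have "cmod (t_coord (base_map p) - t_coord p) \<le> 300 * (1 + cmod (u / v)) * ((cmod v)\<^sup>2 + cmod v * (cmod u)\<^sup>2)"
    using asy(3) by (simp add: coords)
  also have "\<dots> \<le> 300 * (1 + M) * (1 / \<rho>\<^sup>2 + 1 * (M\<^sup>2 / \<rho>\<^sup>2))"
    using t u2 v2 uv16 M by (intro mult_mono add_mono) (auto simp: coords)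
  also have "\<dots> = c / \<rho>\<^sup>2" 
    by (simp add: c_def step_const_def add_divide_distrib distrib_left)
  finally have T: "cmod (t_coord (base_map p) - t_coord p) \<le> c / \<rho>\<^sup>2" .
  have "c / \<rho>\<^sup>2 \<le> 1 / 2"
  proof -
    have "2 * c * 1 \<le> \<rho> * \<rho>" using large \<rho>_pos c M by (intro mult_mono) (auto simp: c_def)
    thus ?thesis using \<rho>_pos by (simp add: field_simps power2_eq_square)
  qed
  hence "\<bar>Re (U_coord (base_map p) - U_coord p - 1)\<bar> \<le> 1 / 2"
    using U abs_Re_le_cmod order_trans by meson
  thus \<rho>': "\<rho> + 1 / 2 \<le> \<rho>'" "\<rho>' \<le> \<rho> + 3 / 2"
    unfolding \<rho>'_def \<rho> minus_complex.sel one_complex.sel abs_le_iff by linarith+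
  have "1 / \<rho>\<^sup>2 \<le> 4 / \<rho> - 4 / \<rho>'" using \<rho>' \<rho>_pos by (intro inverse_square_le_telescope) auto
  hence "c * (1 / \<rho>\<^sup>2) \<le> c * (4 / \<rho> - 4 / \<rho>')" using c M by (intro mult_left_mono) auto
  hence "c / \<rho>\<^sup>2 \<le> 4 * c / \<rho> - 4 * c / \<rho>'" by (simp add: algebra_simps)
  with U T show "cmod (U_coord (base_map p) - U_coord p - 1) \<le> 4 * step_const M / \<rho> - 4 * step_const M / \<rho>'"
    and "cmod (t_coord (base_map p) - t_coord p) \<le> 4 * step_const M / \<rho> - 4 * step_const M / \<rho>'"
    by (auto simp: c_def)
qed

text \<open>The bounds and the growth of the real part support each other: the real part grows because $t$
  stays bounded, and $t$ moves by less than $1$ because the errors telescope.\<close>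
lemma petal_orbit:
  assumes p: "p \<in> petal M" and M: "M > 0"
  defines "\<rho> \<equiv> \<lambda>n. Re (U_coord ((base_map ^^ n) p))" and "K \<equiv> 4 * step_const (M + 1)"
  shows "\<rho> n \<ge> petal_radius M + n / 2"
    and "cmod (t_coord ((base_map ^^ n) p)) \<le> M + 1"
    and "cmod (U_coord ((base_map ^^ Suc n) p) - U_coord ((base_map ^^ n) p) - 1) \<le> K / \<rho> n - K / \<rho> (Suc n)"
    and "cmod (t_coord ((base_map ^^ Suc n) p) - t_coord ((base_map ^^ n) p)) \<le> K / \<rho> n - K / \<rho> (Suc n)"
proof -
  have K: "K \<ge> 1200" using step_const_ge[of "M + 1"] M by (simp add: K_def)
  have R: "petal_radius M = 16 * K" by (simp add: K_def petal_radius_def)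
  have main: "\<rho> n \<ge> petal_radius M + n / 2 \<and> cmod (t_coord ((base_map ^^ n) p) - t_coord p) \<le> K / \<rho> 0 - K / \<rho> n" for n
  proof (induction n)
    case 0
    thus ?case using p by (simp add: petal_def \<rho>_def)
  next
    case (Suc n)
    have \<rho>: "\<rho> 0 > 16 * K" "\<rho> n > 0" using p Suc R K by (auto simp: petal_def \<rho>_def)
    have K0: "K / \<rho> 0 \<le> 1" using \<rho>(1) K by (simp add: field_simps)
    have "K / \<rho> n \<ge> 0" using \<rho> K by simp
    hence "cmod (t_coord ((base_map ^^ n) p) - t_coord p) \<le> 1" using Suc.IH K0 by simp
    hence t: "cmod (t_coord ((base_map ^^ n) p)) \<le> M + 1"
      using p norm_triangle_ineq[of "t_coord p" "t_coord ((base_map ^^ n) p) - t_coord p"]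
      by (simp add: petal_def)
    have large: "\<rho> n \<ge> 2 * step_const (M + 1)" using Suc.IH R K by (simp add: K_def)
    note st = petal_step[OF refl t _ large[unfolded \<rho>_def]]
    show ?case
    proof
      show "\<rho> (Suc n) \<ge> petal_radius M + Suc n / 2"
        using Suc.IH st(1) M by (simp add: \<rho>_def field_simps)
      show "cmod (t_coord ((base_map ^^ Suc n) p) - t_coord p) \<le> K / \<rho> 0 - K / \<rho> (Suc n)"
        using Suc.IH st(4) M
          norm_triangle_ineq[of "t_coord ((base_map ^^ Suc n) p) - t_coord ((base_map ^^ n) p)" "t_coord ((base_map ^^ n) p) - t_coord p"]
        by (simp add: \<rho>_def K_def)
    qed
  qed
  thus \<rho>n: "\<rho> n \<ge> petal_radius M + n / 2" by blast
  have \<rho>: "\<rho> 0 > 16 * K" "\<rho> n > 0" using p \<rho>n R K by (auto simp: petal_def \<rho>_def)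
  have K0: "K / \<rho> 0 \<le> 1" using \<rho>(1) K by (simp add: field_simps)
  have "K / \<rho> n \<ge> 0" using \<rho> K by simp
  hence "cmod (t_coord ((base_map ^^ n) p) - t_coord p) \<le> 1" using main[of n] K0 by simp
  thus t: "cmod (t_coord ((base_map ^^ n) p)) \<le> M + 1"
    using p norm_triangle_ineq[of "t_coord p" "t_coord ((base_map ^^ n) p) - t_coord p"]
    by (simp add: petal_def)
  have large: "\<rho> n \<ge> 2 * step_const (M + 1)" using \<rho>n R K by (simp add: K_def)
  note st = petal_step[OF refl t _ large[unfolded \<rho>_def]]
  from st(3,4) M show "cmod (U_coord ((base_map ^^ Suc n) p) - U_coord ((base_map ^^ n) p) - 1) \<le> K / \<rho> n - K / \<rho> (Suc n)"
    and "cmod (t_coord ((base_map ^^ Suc n) p) - t_coord ((base_map ^^ n) p)) \<le> K / \<rho> n - K / \<rho> (Suc n)"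
    by (auto simp: \<rho>_def K_def)
qed

lemma radius_pos: "M \<ge> 0 \<Longrightarrow> petal_radius M > 0"
  using step_const_ge[of "M + 1"] by (simp add: petal_radius_def)

lemma petal_imp_basin:
  assumes "p \<in> petal M" "M > 0" shows "p \<in> base_basin"
proof -
  have p0: "snd p \<noteq> 0"
    using assms radius_pos[of M] by (auto simp: petal_def U_coord_def)
  define u v where "u = (\<lambda>n. fst ((base_map ^^ n) p))" and "v = (\<lambda>n. snd ((base_map ^^ n) p))"
  have v0: "v n \<noteq> 0" for n using p0 by (simp add: v_def)
  have vb: "cmod (v n) \<le> 2 / real n" if "n > 0" for n
  proof -
    have "Re (1 / v n) \<ge> n / 2"
      using petal_orbit(1)[OF assms, of n] radius_pos[of M] assms(2) by (simp add: v_def U_coord_def)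
    hence "cmod (v n) \<le> 1 / (n / 2)" using that by (intro norm_le_inverse_Re) auto
    thus ?thesis by simp
  qed
  have lim: "(\<lambda>n. c / real n) \<longlonglongrightarrow> 0" for c by real_asymp
  have "v \<longlonglongrightarrow> 0"
    by (rule Lim_null_comparison[OF _ lim[of 2]]) (use vb in \<open>auto intro: eventually_sequentiallyI[of 1]\<close>)
  moreover have ub: "cmod (u n) \<le> (2 * (M + 1)) / real n" if "n > 0" for n
  proof -
    have "cmod (u n) = cmod (t_coord ((base_map ^^ n) p)) * cmod (v n)"
      using v0[of n] by (simp add: u_def v_def t_coord_def norm_divide)
    also have "\<dots> \<le> (M + 1) * (2 / real n)"
      using petal_orbit(2)[OF assms, of n] vb[OF that] assms(2) by (intro mult_mono) auto
    finally show ?thesis by (simp add: mult.commute)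
  qed
  have "u \<longlonglongrightarrow> 0"
    by (rule Lim_null_comparison[OF _ lim[of "2 * (M + 1)"]]) (use ub in \<open>auto intro: eventually_sequentiallyI[of 1]\<close>)
  ultimately have "(\<lambda>n. (u n, v n)) \<longlonglongrightarrow> (0, 0)" by (intro tendsto_Pair)
  thus ?thesis using p0 by (simp add: base_basin_def u_def v_def zero_prod_def)
qed


text \<open>Two Gronwall arguments for $y_n = 1 + |t_n|$ with $\rho_n = \mathrm{Re}\, U_n$. Since
  $u_n \to 0$, the relative growth of $y$ is at most $1 / (8 \rho_n)$, so $y_n^2 / \rho_n$ does not
  increase. This gives $|u_n|^2 \le C / \rho_n$, so the relative growth of $y$ is in fact
  $O(\rho_n^{-2})$, which is summable, and $y$ is bounded.\<close>
lemma basin_enters_petal: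
  assumes p: "p \<in> base_basin"
  obtains M n where "M > 0" "(base_map ^^ n) p \<in> petal M"
proof -
  define u v where "u = (\<lambda>n. fst ((base_map ^^ n) p))" and "v = (\<lambda>n. snd ((base_map ^^ n) p))"
  define U t where "U = (\<lambda>n. U_coord ((base_map ^^ n) p))" and "t = (\<lambda>n. t_coord ((base_map ^^ n) p))"
  define \<rho> where "\<rho> = (\<lambda>n. Re (U n))"
  define y where "y = (\<lambda>n. 1 + cmod (t n))"
  define a where "a = (\<lambda>n. 300 * ((cmod (v n))\<^sup>2 + cmod (v n) * (cmod (u n))\<^sup>2))"
  have v0: "v n \<noteq> 0" for n using p by (simp add: base_basin_def v_def)
  have y1: "y n \<ge> 1" for n by (simp add: y_def)
  have "(\<lambda>n. (base_map ^^ n) p) \<longlonglongrightarrow> 0" using p by (simp add: base_basin_def)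
  from tendsto_fst[OF this] tendsto_snd[OF this] have ulim: "u \<longlonglongrightarrow> 0" and vlim: "v \<longlonglongrightarrow> 0"
    by (simp_all add: u_def v_def)
  have base_step: "cmod (U (Suc n) - U n - 1) \<le> 80 * ((cmod (u n))\<^sup>2 + (cmod (v n))\<^sup>2)"
    "y (Suc n) \<le> y n * (1 + a n)" if "cmod (u n) \<le> 1 / 16" "cmod (v n) \<le> 1 / 16" for n
  proof -
    note asy = base_asymptotics[OF that v0]
    have coords: "U (Suc n) = 1 / base_snd (u n) (v n)" "t (Suc n) = base_fst (u n) (v n) / base_snd (u n) (v n)"
      "U n = 1 / v n" "t n = u n / v n"
      by (auto simp: U_coord_def t_coord_def base_map_def u_def v_def U_def t_def)
    show "cmod (U (Suc n) - U n - 1) \<le> 80 * ((cmod (u n))\<^sup>2 + (cmod (v n))\<^sup>2)"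
      using asy(2) by (simp add: coords)
    have "cmod (t (Suc n) - t n) \<le> y n * a n"
      using asy(3) unfolding coords y_def a_def by (simp only: mult_ac)
    moreover have "cmod (t (Suc n)) \<le> cmod (t n) + cmod (t (Suc n) - t n)"
      using norm_triangle_ineq[of "t n" "t (Suc n) - t n"] by simp
    ultimately show "y (Suc n) \<le> y n * (1 + a n)" by (simp add: y_def algebra_simps)
  qed
  have l1: "(\<lambda>n. 80 * ((cmod (u n))\<^sup>2 + (cmod (v n))\<^sup>2)) \<longlonglongrightarrow> 80 * ((cmod 0)\<^sup>2 + (cmod 0)\<^sup>2)"
    by (intro tendsto_intros ulim vlim)
  have l2: "(\<lambda>n. 300 * (cmod (v n) + (cmod (u n))\<^sup>2)) \<longlonglongrightarrow> 300 * (cmod 0 + (cmod 0)\<^sup>2)"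
    by (intro tendsto_intros ulim vlim)
  have "\<forall>\<^sub>F n in sequentially. cmod (u n) < 1 / 16 \<and> cmod (v n) < 1 / 16 \<and>
      80 * ((cmod (u n))\<^sup>2 + (cmod (v n))\<^sup>2) < 1 / 2 \<and> 300 * (cmod (v n) + (cmod (u n))\<^sup>2) < 1 / 8"
    using l1 l2
    by (intro eventually_conj order_tendstoD(2)[OF tendsto_norm_zero[OF ulim]]
          order_tendstoD(2)[OF tendsto_norm_zero[OF vlim]] order_tendstoD(2)[OF l1]
          order_tendstoD(2)[OF l2]) auto
  then obtain N where N: "\<And>n. n \<ge> N \<Longrightarrow> cmod (u n) \<le> 1 / 16" "\<And>n. n \<ge> N \<Longrightarrow> cmod (v n) \<le> 1 / 16"
      "\<And>n. n \<ge> N \<Longrightarrow> 80 * ((cmod (u n))\<^sup>2 + (cmod (v n))\<^sup>2) \<le> 1 / 2"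
      "\<And>n. n \<ge> N \<Longrightarrow> 300 * (cmod (v n) + (cmod (u n))\<^sup>2) \<le> 1 / 8"
    unfolding eventually_sequentially by (meson less_imp_le)
  have \<rho>_step: "\<rho> n + 1 / 2 \<le> \<rho> (Suc n)" "\<rho> (Suc n) \<le> \<rho> n + 3 / 2" if "n \<ge> N" for n
  proof -
    have "\<bar>Re (U (Suc n) - U n - 1)\<bar> \<le> 1 / 2"
      using base_step(1)[OF N(1,2)[OF that]] N(3)[OF that] abs_Re_le_cmod[of "U (Suc n) - U n - 1"] by linarith
    thus "\<rho> n + 1 / 2 \<le> \<rho> (Suc n)" "\<rho> (Suc n) \<le> \<rho> n + 3 / 2"
      unfolding \<rho>_def minus_complex.sel one_complex.sel abs_le_iff by linarith+
  qed
  have grow: "\<rho> (N + n) \<ge> \<rho> N + n / 2" for n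
  proof (induction n)
    case (Suc n)
    thus ?case using \<rho>_step(1)[of "N + n"] by (simp add: field_simps)
  qed simp
  define N1 where "N1 = N + nat \<lceil>2 * (2 - \<rho> N)\<rceil>"
  have NN: "N \<le> N1" by (simp add: N1_def)
  have \<rho>2: "\<rho> n \<ge> 2" if "n \<ge> N1" for n
  proof -
    define d where "d = real (n - N)"
    have "d \<ge> 2 * (2 - \<rho> N)" unfolding d_def using that unfolding N1_def by linarith
    moreover have "\<rho> n \<ge> \<rho> N + d / 2"
      unfolding d_def using grow[of "n - N"] that NN by simp
    ultimately have "2 * (2 - \<rho> N) \<le> d" "2 * \<rho> N + d \<le> 2 * \<rho> n" by auto
    thus ?thesis by (simp add: algebra_simps)
  qed
  have vb: "cmod (v n) \<le> 1 / \<rho> n" if "n \<ge> N1" for n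
    using \<rho>2[OF that] by (intro norm_le_inverse_Re) (auto simp: \<rho>_def U_def U_coord_def v_def)
  define C where "C = (y N1)\<^sup>2 / \<rho> N1"
  have C0: "C \<ge> 0" using \<rho>2[of N1] by (simp add: C_def)
  have ysq: "(y n)\<^sup>2 \<le> C * \<rho> n" if "n \<ge> N1" for n
    using that
  proof (induction rule: dec_induct)
    case base
    thus ?case using \<rho>2[of N1] by (simp add: C_def)
  next
    case (step n)
    have \<rho>n: "\<rho> n \<ge> 2" using \<rho>2 step by simp
    have "a n = cmod (v n) * (300 * (cmod (v n) + (cmod (u n))\<^sup>2))"
      by (simp add: a_def algebra_simps power2_eq_square)
    also have "\<dots> \<le> 1 / \<rho> n * (1 / 8)"
      using vb[of n] N(4)[of n] step NN \<rho>n by (intro mult_mono) auto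
    finally have an: "a n \<le> 1 / (8 * \<rho> n)" by simp
    have a0: "a n \<ge> 0" by (simp add: a_def)
    have "(y (Suc n))\<^sup>2 \<le> (y n * (1 + a n))\<^sup>2"
      using \<open>N1 \<le> n\<close> NN y1[of "Suc n"] by (intro power_mono N base_step) auto
    also have "\<dots> = (y n)\<^sup>2 * (1 + a n)\<^sup>2" by (simp add: power_mult_distrib)
    also have "\<dots> \<le> (C * \<rho> n) * (1 + 1 / (8 * \<rho> n))\<^sup>2"
      using step.IH an a0 C0 \<rho>n by (intro mult_mono power_mono) auto
    also have "\<dots> = C * (\<rho> n + 1 / 4 + 1 / (64 * \<rho> n))"
      using \<rho>n by (simp add: field_simps power2_eq_square)
    also have "\<dots> \<le> C * \<rho> (Suc n)"
    proof (intro mult_left_mono C0)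
      have "1 / (64 * \<rho> n) \<le> 1 / 4" using \<rho>n by (simp add: field_simps)
      thus "\<rho> n + 1 / 4 + 1 / (64 * \<rho> n) \<le> \<rho> (Suc n)" using \<rho>_step(1)[of n] step NN by simp
    qed
    finally show ?case .
  qed
  define c where "c = 300 * (1 + C)"
  have c0: "c \<ge> 0" using C0 by (simp add: c_def)
  have ab: "a n \<le> c / (\<rho> n)\<^sup>2" if "n \<ge> N1" for n
  proof -
    have \<rho>n: "\<rho> n \<ge> 2" using \<rho>2 that by simp
    have v2: "(cmod (v n))\<^sup>2 \<le> 1 / (\<rho> n)\<^sup>2"
      using power_mono[OF vb[OF that], of 2] by (simp add: power_divide)
    have "cmod (u n) \<le> y n * cmod (v n)"
      using v0[of n] by (simp add: y_def t_def t_coord_def norm_divide u_def v_def field_simps)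
    hence "(cmod (u n))\<^sup>2 \<le> (y n)\<^sup>2 * (cmod (v n))\<^sup>2"
      using power_mono[of "cmod (u n)" "y n * cmod (v n)" 2] by (simp add: power_mult_distrib)
    also have "\<dots> \<le> (C * \<rho> n) * (1 / (\<rho> n)\<^sup>2)"
      using ysq[OF that] v2 C0 \<rho>n by (intro mult_mono) auto
    also have "\<dots> = C / \<rho> n" using \<rho>n by (simp add: power2_eq_square)
    finally have "(cmod (u n))\<^sup>2 \<le> C / \<rho> n" .
    hence "cmod (v n) * (cmod (u n))\<^sup>2 \<le> 1 / \<rho> n * (C / \<rho> n)"
      using vb[OF that] \<rho>n by (intro mult_mono) auto
    hence "a n \<le> 300 * (1 / (\<rho> n)\<^sup>2 + C / (\<rho> n)\<^sup>2)"
      using v2 by (simp add: a_def power2_eq_square)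
    also have "\<dots> = c / (\<rho> n)\<^sup>2" by (simp add: c_def add_divide_distrib distrib_left)
    finally show ?thesis .
  qed
  \<comment> \<open>since $y$ grows by a factor of at most $e^{c / \<rho>^2}$, the quantity $y e^{4 c / \<rho>}$ does not increase\<close>
  define Y where "Y = y N1 * exp (4 * c / \<rho> N1)"
  have ybound: "y n * exp (4 * c / \<rho> n) \<le> Y" if "n \<ge> N1" for n
    using that
  proof (induction rule: dec_induct)
    case (step n)
    have \<rho>n: "\<rho> n \<ge> 2" using \<rho>2 step by simp
    have "y (Suc n) \<le> y n * (1 + a n)"
      using \<open>N1 \<le> n\<close> NN by (intro N base_step) auto
    also have "1 + a n \<le> exp (a n)" by (rule exp_ge_add_one_self)
    also have "exp (a n) \<le> exp (4 * c / \<rho> n - 4 * c / \<rho> (Suc n))"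
    proof -
      have "1 / (\<rho> n)\<^sup>2 \<le> 4 / \<rho> n - 4 / \<rho> (Suc n)"
        using \<rho>n \<rho>_step[of n] step NN by (intro inverse_square_le_telescope) auto
      hence "c * (1 / (\<rho> n)\<^sup>2) \<le> c * (4 / \<rho> n - 4 / \<rho> (Suc n))" using c0 by (rule mult_left_mono)
      thus ?thesis using ab[of n] step by (simp add: algebra_simps)
    qed
    finally have "y (Suc n) \<le> y n * exp (4 * c / \<rho> n - 4 * c / \<rho> (Suc n))"
      using y1[of n] by simp
    hence "y (Suc n) * exp (4 * c / \<rho> (Suc n)) \<le> y n * exp (4 * c / \<rho> n)"
      by (simp add: exp_diff field_simps)
    thus ?case using step.IH by simp
  qed (simp add: Y_def)
  have tb: "cmod (t n) < Y" if "n \<ge> N1" for n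
  proof -
    have "4 * c / \<rho> n \<ge> 0" using c0 \<rho>2[OF that] by simp
    hence "y n * 1 \<le> y n * exp (4 * c / \<rho> n)" using y1[of n] by (intro mult_left_mono) auto
    thus ?thesis using ybound[OF that] by (simp add: y_def)
  qed
  define n where "n = N1 + nat \<lceil>2 * (petal_radius Y + 1 - \<rho> N)\<rceil>"
  define d where "d = real (n - N)"
  have "d \<ge> 2 * (petal_radius Y + 1 - \<rho> N)" unfolding d_def n_def using NN by linarith
  moreover have "\<rho> n \<ge> \<rho> N + d / 2"
    unfolding d_def using grow[of "n - N"] NN by (simp add: n_def)
  ultimately have "2 * (petal_radius Y + 1 - \<rho> N) \<le> d" "2 * \<rho> N + d \<le> 2 * \<rho> n" by auto
  hence "\<rho> n > petal_radius Y" by (simp add: algebra_simps)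
  moreover have "cmod (t n) < Y" by (rule tb) (simp add: n_def)
  ultimately have "(base_map ^^ n) p \<in> petal Y" by (simp add: petal_def \<rho>_def U_def t_def)
  moreover have "Y > 0" using \<open>cmod (t n) < Y\<close> norm_ge_zero[of "t n"] by linarith
  ultimately show ?thesis using that by blast
qed

section \<open>The Fatou map\<close>

definition chart :: "complex \<times> complex \<Rightarrow> complex \<times> complex" where
  "chart p = (U_coord p, t_coord p)"

definition chart_inv :: "complex \<times> complex \<Rightarrow> complex \<times> complex" where
  "chart_inv q = (snd q / fst q, 1 / fst q)"

definition fatou :: "complex \<times> complex \<Rightarrow> complex \<times> complex" where
  "fatou p = (lim (\<lambda>n. U_coord ((base_map ^^ n) p) - of_nat n), lim (\<lambda>n. t_coord ((base_map ^^ n) p)))"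

lemma chart_inv_chart: "snd p \<noteq> 0 \<Longrightarrow> chart_inv (chart p) = p"
  by (cases p) (simp add: chart_def chart_inv_def U_coord_def t_coord_def)

lemma chart_chart_inv: "fst q \<noteq> 0 \<Longrightarrow> chart (chart_inv q) = q"
  by (cases q) (simp add: chart_def chart_inv_def U_coord_def t_coord_def)

lemma snd_nonzero_petal: "p \<in> petal M \<Longrightarrow> M > 0 \<Longrightarrow> snd p \<noteq> 0"
  using radius_pos[of M] by (auto simp: petal_def U_coord_def)

lemma cdiff_U_coord: "snd p \<noteq> 0 \<Longrightarrow> cdiff pscale (*) U_coord p"
  unfolding U_coord_def by (intro cdiff_divide cdiff_const cdiff_snd)

lemma cdiff_t_coord: "snd p \<noteq> 0 \<Longrightarrow> cdiff pscale (*) t_coord p"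
  unfolding t_coord_def by (intro cdiff_divide cdiff_fst cdiff_snd)

lemma cdiff_chart: "snd p \<noteq> 0 \<Longrightarrow> cdiff pscale pscale chart p"
  unfolding chart_def by (intro cdiff_Pair cdiff_U_coord cdiff_t_coord)

lemma cdiff_chart_inv: "fst q \<noteq> 0 \<Longrightarrow> cdiff pscale pscale chart_inv q"
  unfolding chart_inv_def by (intro cdiff_Pair cdiff_divide cdiff_const cdiff_fst cdiff_snd)

lemma cdiff_funpow:
  assumes "\<And>p. cdiff s s f p" shows "cdiff s s (f ^^ n) p"
proof (induction n)
  case 0
  show ?case using cdiff_id[of s p] by (simp add: id_def)
next
  case (Suc n)
  show ?case using cdiff_comp[OF Suc assms] by (simp add: o_def)
qed

lemma petal_open:
  assumes "M > 0" shows "open (petal M)"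
proof -
  have S: "open {p :: complex \<times> complex. snd p \<noteq> 0}"
    by (intro open_Collect_neq continuous_intros)
  have "petal M = chart -` ({z. Re z > petal_radius M} \<times> ball 0 M) \<inter> {p. snd p \<noteq> 0}"
    (is "_ = ?S")
    using snd_nonzero_petal[OF _ assms] by (auto simp: petal_def chart_def)
  moreover have "continuous_on {p. snd p \<noteq> 0} chart"
    using cdiff_chart cdiff_continuous by (intro continuous_at_imp_continuous_on) blast
  hence "open ?S"
    by (rule continuous_on_open_vimage[OF S, THEN iffD1, rule_format])
       (intro open_Times open_halfspace_Re_gt open_ball)
  ultimately show ?thesis by simp
qed

lemma petal_cauchy:
  assumes p: "p \<in> petal M" and M: "M > 0" and nm: "n \<le> m"
  defines "K \<equiv> 4 * step_const (M + 1)"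
  shows "cmod ((U_coord ((base_map ^^ m) p) - of_nat m) - (U_coord ((base_map ^^ n) p) - of_nat n)) \<le> K / (petal_radius M + n / 2)"
    and "cmod (t_coord ((base_map ^^ m) p) - t_coord ((base_map ^^ n) p)) \<le> K / (petal_radius M + n / 2)"
proof -
  define \<rho> where "\<rho> = (\<lambda>n. Re (U_coord ((base_map ^^ n) p)))"
  have K: "K > 0" using step_const_ge[of "M + 1"] M by (simp add: K_def)
  note orb = petal_orbit[OF p M, folded K_def \<rho>_def]
  have \<rho>_pos: "\<rho> n > 0" "petal_radius M + n / 2 > 0" for n
    using orb(1)[of n] radius_pos[of M] M by (auto simp: \<rho>_def)
  have "K / \<rho> n - K / \<rho> m \<le> K / \<rho> n" using K \<rho>_pos(1)[of m] by simp
  also have "\<dots> \<le> K / (petal_radius M + n / 2)"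
    using orb(1)[of n] K \<rho>_pos by (intro divide_left_mono) (auto simp: \<rho>_def)
  finally have b: "K / \<rho> n - K / \<rho> m \<le> K / (petal_radius M + n / 2)" .
  have "cmod ((U_coord ((base_map ^^ m) p) - of_nat m) - (U_coord ((base_map ^^ n) p) - of_nat n)) \<le> K / \<rho> n - K / \<rho> m"
    using orb(3) by (intro telescope_norm_bound[OF _ nm]) (simp add: algebra_simps \<rho>_def)
  with b show "cmod ((U_coord ((base_map ^^ m) p) - of_nat m) - (U_coord ((base_map ^^ n) p) - of_nat n)) \<le> K / (petal_radius M + n / 2)"
    by simp
  have "cmod (t_coord ((base_map ^^ m) p) - t_coord ((base_map ^^ n) p)) \<le> K / \<rho> n - K / \<rho> m"
    using orb(4) by (intro telescope_norm_bound[OF _ nm]) (simp add: \<rho>_def)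
  with b show "cmod (t_coord ((base_map ^^ m) p) - t_coord ((base_map ^^ n) p)) \<le> K / (petal_radius M + n / 2)"
    by simp
qed

lemma uniform_limit_of_cauchy_bound:
  fixes f :: "nat \<Rightarrow> 'a \<Rightarrow> complex"
  assumes bd: "\<And>n m x. x \<in> S \<Longrightarrow> n \<le> m \<Longrightarrow> cmod (f m x - f n x) \<le> \<epsilon> n" and \<epsilon>: "\<epsilon> \<longlonglongrightarrow> 0"
  shows "uniform_limit S f (\<lambda>x. lim (\<lambda>n. f n x)) sequentially"
proof -
  have "uniformly_Cauchy_on S f"
  proof (rule uniformly_Cauchy_onI')
    fix e :: real assume "e > 0"
    then obtain N where N: "\<And>n. n \<ge> N \<Longrightarrow> \<epsilon> n < e"
      using order_tendstoD(2)[OF \<epsilon>] unfolding eventually_sequentially by blast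
    show "\<exists>M. \<forall>x\<in>S. \<forall>m\<ge>M. \<forall>n>m. dist (f m x) (f n x) < e"
      using N bd by (intro exI[of _ N]) (metis dist_commute dist_norm less_imp_le order_le_less_trans)
  qed
  thus ?thesis
    using Cauchy_uniformly_convergent uniformly_convergent_uniform_limit_iff by blast
qed

lemma divide_linear_tendsto_0: "(\<lambda>n. K / (R + real n / 2)) \<longlonglongrightarrow> 0"
proof (rule tendsto_divide_0[OF tendsto_const filterlim_at_top_imp_at_infinity])
  have "filterlim (\<lambda>n. 1 / 2 * real n) at_top sequentially"
    by (rule filterlim_tendsto_pos_mult_at_top[OF tendsto_const _ filterlim_real_sequentially]) simp
  thus "filterlim (\<lambda>n. R + real n / 2) at_top sequentially"
    by (intro filterlim_tendsto_add_at_top[OF tendsto_const]) simp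
qed

lemma petal_uniform_limit:
  assumes "M > 0"
  shows "uniform_limit (petal M) (\<lambda>n p. U_coord ((base_map ^^ n) p) - of_nat n) (\<lambda>p. fst (fatou p)) sequentially"
    and "uniform_limit (petal M) (\<lambda>n p. t_coord ((base_map ^^ n) p)) (\<lambda>p. snd (fatou p)) sequentially"
  unfolding fatou_def fst_conv snd_conv
proof -
  let ?\<epsilon> = "\<lambda>n. 4 * step_const (M + 1) / (petal_radius M + real n / 2)"
  show "uniform_limit (petal M) (\<lambda>n p. U_coord ((base_map ^^ n) p) - of_nat n)
      (\<lambda>p. lim (\<lambda>n. U_coord ((base_map ^^ n) p) - of_nat n)) sequentially"
    by (rule uniform_limit_of_cauchy_bound[where \<epsilon> = ?\<epsilon>])
       (use petal_cauchy(1)[OF _ assms] divide_linear_tendsto_0 in blast)+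
  show "uniform_limit (petal M) (\<lambda>n p. t_coord ((base_map ^^ n) p)) (\<lambda>p. lim (\<lambda>n. t_coord ((base_map ^^ n) p))) sequentially"
    by (rule uniform_limit_of_cauchy_bound[where \<epsilon> = ?\<epsilon>])
       (use petal_cauchy(2)[OF _ assms] divide_linear_tendsto_0 in blast)+
qed

lemma cdiff_fatou_petal:
  assumes p: "p \<in> petal M" and M: "M > 0" shows "cdiff pscale pscale fatou p"
proof -
  obtain r where r: "r > 0" "cball p r \<subseteq> petal M"
    using petal_open[OF M] p open_contains_cball by blast
  note lim = uniform_limit_on_subset[OF petal_uniform_limit(1)[OF M] r(2)]
    uniform_limit_on_subset[OF petal_uniform_limit(2)[OF M] r(2)]
  have snd0: "snd ((base_map ^^ n) x) \<noteq> 0" if "x \<in> cball p r" for n x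
    using that r(2) snd_nonzero_petal[OF _ M, of x] by auto
  have "cdiff pscale (*) (\<lambda>p. fst (fatou p)) p"
    by (rule cdiff_uniform_limit[OF _ r(1) lim(1)])
       (intro cdiff_diff cdiff_const cdiff_comp[OF cdiff_funpow[OF cdiff_base] cdiff_U_coord] snd0)
  moreover have "cdiff pscale (*) (\<lambda>p. snd (fatou p)) p"
    by (rule cdiff_uniform_limit[OF _ r(1) lim(2)])
       (intro cdiff_comp[OF cdiff_funpow[OF cdiff_base] cdiff_t_coord] snd0)
  ultimately have "cdiff pscale pscale (\<lambda>p. (fst (fatou p), snd (fatou p))) p"
    by (rule cdiff_Pair)
  thus ?thesis by simp
qed

lemma fatou_near_chart:
  assumes p: "p \<in> petal M" and M: "M > 0"
  shows "cmod (fst (fatou p) - U_coord p) \<le> 1 / 16" "cmod (snd (fatou p) - t_coord p) \<le> 1 / 16"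
proof -
  have K: "4 * step_const (M + 1) / (petal_radius M + real 0 / 2) = 1 / 16"
    using radius_pos[of M] M by (simp add: petal_radius_def)
  note lim = tendsto_uniform_limitI[OF petal_uniform_limit(1)[OF M] p]
     tendsto_uniform_limitI[OF petal_uniform_limit(2)[OF M] p]
  show "cmod (fst (fatou p) - U_coord p) \<le> 1 / 16"
  proof (rule tendsto_upperbound)
    show "(\<lambda>n. cmod ((U_coord ((base_map ^^ n) p) - of_nat n) - U_coord p)) \<longlonglongrightarrow> cmod (fst (fatou p) - U_coord p)"
      by (rule tendsto_norm[OF tendsto_diff[OF lim(1) tendsto_const]])
    show "\<forall>\<^sub>F n in sequentially. cmod ((U_coord ((base_map ^^ n) p) - of_nat n) - U_coord p) \<le> 1 / 16"
      using petal_cauchy(1)[OF p M, of 0] unfolding K by (intro always_eventually) simp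
  qed simp
  show "cmod (snd (fatou p) - t_coord p) \<le> 1 / 16"
  proof (rule tendsto_upperbound)
    show "(\<lambda>n. cmod (t_coord ((base_map ^^ n) p) - t_coord p)) \<longlonglongrightarrow> cmod (snd (fatou p) - t_coord p)"
      by (rule tendsto_norm[OF tendsto_diff[OF lim(2) tendsto_const]])
    show "\<forall>\<^sub>F n in sequentially. cmod (t_coord ((base_map ^^ n) p) - t_coord p) \<le> 1 / 16"
      using petal_cauchy(2)[OF p M, of 0] unfolding K by (intro always_eventually) simp
  qed simp
qed

lemma basin_base_pow_iff: "(base_map ^^ n) p \<in> base_basin \<longleftrightarrow> p \<in> base_basin"
proof -
  have "(\<lambda>m. (base_map ^^ m) ((base_map ^^ n) p)) = (\<lambda>m. (base_map ^^ (m + n)) p)"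
    by (simp add: funpow_add)
  moreover have "(\<lambda>m. (base_map ^^ (m + n)) p) \<longlonglongrightarrow> 0 \<longleftrightarrow> (\<lambda>m. (base_map ^^ m) p) \<longlonglongrightarrow> 0"
    using LIMSEQ_offset[where f = "\<lambda>m. (base_map ^^ m) p" and k = n]
      LIMSEQ_ignore_initial_segment[where f = "\<lambda>m. (base_map ^^ m) p" and k = n] by blast
  ultimately show ?thesis unfolding base_basin_def by simp
qed

lemma basin_converges:
  assumes "p \<in> base_basin"
  shows "(\<lambda>n. U_coord ((base_map ^^ n) p) - of_nat n) \<longlonglongrightarrow> fst (fatou p)"
    and "(\<lambda>n. t_coord ((base_map ^^ n) p)) \<longlonglongrightarrow> snd (fatou p)"
proof -
  obtain M k where M: "M > 0" and k: "(base_map ^^ k) p \<in> petal M"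
    using basin_enters_petal[OF assms] by blast
  have "(\<lambda>n. U_coord ((base_map ^^ n) ((base_map ^^ k) p)) - of_nat n - of_nat k) \<longlonglongrightarrow> fst (fatou ((base_map ^^ k) p)) - of_nat k"
    by (rule tendsto_diff[OF tendsto_uniform_limitI[OF petal_uniform_limit(1)[OF M] k] tendsto_const])
  hence "(\<lambda>n. U_coord ((base_map ^^ (n + k)) p) - of_nat (n + k)) \<longlonglongrightarrow> fst (fatou ((base_map ^^ k) p)) - of_nat k"
    by (simp add: funpow_add algebra_simps)
  hence *: "(\<lambda>n. U_coord ((base_map ^^ n) p) - of_nat n) \<longlonglongrightarrow> fst (fatou ((base_map ^^ k) p)) - of_nat k"
    by (rule LIMSEQ_offset[where f = "\<lambda>n. U_coord ((base_map ^^ n) p) - of_nat n"])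
  thus "(\<lambda>n. U_coord ((base_map ^^ n) p) - of_nat n) \<longlonglongrightarrow> fst (fatou p)"
    using limI[OF *] by (simp only: fatou_def fst_conv)
  have "(\<lambda>n. t_coord ((base_map ^^ (n + k)) p)) \<longlonglongrightarrow> snd (fatou ((base_map ^^ k) p))"
    using tendsto_uniform_limitI[OF petal_uniform_limit(2)[OF M] k] by (simp add: funpow_add)
  hence *: "(\<lambda>n. t_coord ((base_map ^^ n) p)) \<longlonglongrightarrow> snd (fatou ((base_map ^^ k) p))"
    by (rule LIMSEQ_offset[where f = "\<lambda>n. t_coord ((base_map ^^ n) p)"])
  thus "(\<lambda>n. t_coord ((base_map ^^ n) p)) \<longlonglongrightarrow> snd (fatou p)"
    using limI[OF *] by (simp only: fatou_def snd_conv)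
qed

lemma fatou_base_pow:
  assumes "p \<in> base_basin" shows "fatou ((base_map ^^ k) p) = fatou p + (of_nat k, 0)"
proof -
  have Gk: "(base_map ^^ k) p \<in> base_basin" using assms by (simp add: basin_base_pow_iff)
  have "(\<lambda>n. U_coord ((base_map ^^ n) ((base_map ^^ k) p)) - of_nat n - of_nat k) \<longlonglongrightarrow> fst (fatou ((base_map ^^ k) p)) - of_nat k"
    by (rule tendsto_diff[OF basin_converges(1)[OF Gk] tendsto_const])
  moreover have "(\<lambda>n. U_coord ((base_map ^^ (n + k)) p) - of_nat (n + k)) \<longlonglongrightarrow> fst (fatou p)"
    using LIMSEQ_ignore_initial_segment[OF basin_converges(1)[OF assms], of k] by blast
  hence "(\<lambda>n. U_coord ((base_map ^^ n) ((base_map ^^ k) p)) - of_nat n - of_nat k) \<longlonglongrightarrow> fst (fatou p)"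
    by (simp add: funpow_add algebra_simps)
  ultimately have fst: "fst (fatou ((base_map ^^ k) p)) - of_nat k = fst (fatou p)"
    by (rule LIMSEQ_unique)
  have "(\<lambda>n. t_coord ((base_map ^^ n) ((base_map ^^ k) p))) \<longlonglongrightarrow> snd (fatou p)"
    using LIMSEQ_ignore_initial_segment[OF basin_converges(2)[OF assms], of k] by (simp add: funpow_add)
  hence "snd (fatou ((base_map ^^ k) p)) = snd (fatou p)"
    by (rule LIMSEQ_unique[OF basin_converges(2)[OF Gk]])
  with fst show ?thesis by (simp add: prod_eq_iff algebra_simps)
qed

section \<open>The Fatou map is biholomorphic onto the plane\<close>

text \<open>Expressed in the coordinates $(U, t)$ and shrunk by $1$ in all directions from the petal for
  \<open>M + 1\<close>, so that the Cauchy estimate can be applied on balls of radius $1$.\<close>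
definition inner_petal :: "real \<Rightarrow> (complex \<times> complex) set" where
  "inner_petal M = {q. Re (fst q) > petal_radius (M + 1) + 1 \<and> cmod (snd q) < M}"

definition fatou_defect :: "complex \<times> complex \<Rightarrow> complex \<times> complex" where
  "fatou_defect q = fatou (chart_inv q) - q"

lemma chart_inv_in_petal:
  assumes "M > 0" "Re (fst q) > petal_radius M" "cmod (snd q) < M" shows "chart_inv q \<in> petal M" "fst q \<noteq> 0"
proof -
  show "fst q \<noteq> 0" using assms radius_pos[of M] by auto
  from chart_chart_inv[OF this] have "U_coord (chart_inv q) = fst q" "t_coord (chart_inv q) = snd q"
    by (auto simp: chart_def prod_eq_iff)
  thus "chart_inv q \<in> petal M" using assms by (simp add: petal_def)
qed

lemma cball_inner_petal:
  assumes q: "q \<in> inner_petal M" and M: "M > 0" and x: "x \<in> cball q 1"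
  shows "chart_inv x \<in> petal (M + 1)" "fst x \<noteq> 0"
proof -
  have "norm (fst x - fst q) \<le> 1" "norm (snd x - snd q) \<le> 1"
    using x dist_fst_le[of x q] dist_snd_le[of x q] by (simp_all add: dist_norm norm_minus_commute[of q])
  hence "\<bar>Re (fst x - fst q)\<bar> \<le> 1" "cmod (snd x) \<le> cmod (snd q) + 1"
    using abs_Re_le_cmod[of "fst x - fst q"] norm_triangle_ineq[of "snd q" "snd x - snd q"] by auto
  hence "Re (fst x) > petal_radius (M + 1)" "cmod (snd x) < M + 1"
    using q by (auto simp: inner_petal_def)
  thus "chart_inv x \<in> petal (M + 1)" "fst x \<noteq> 0" using M chart_inv_in_petal[of "M + 1" x] by auto
qed

lemma fatou_defect_small:
  assumes "q \<in> inner_petal M" "M > 0" "x \<in> cball q 1"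
  shows "cmod (fst (fatou_defect x)) \<le> 1 / 16" "cmod (snd (fatou_defect x)) \<le> 1 / 16"
proof -
  note c = cball_inner_petal[OF assms]
  have "chart (chart_inv x) = x" by (rule chart_chart_inv[OF c(2)])
  hence "U_coord (chart_inv x) = fst x" "t_coord (chart_inv x) = snd x"
    by (auto simp: chart_def prod_eq_iff)
  thus "cmod (fst (fatou_defect x)) \<le> 1 / 16" "cmod (snd (fatou_defect x)) \<le> 1 / 16"
    using fatou_near_chart[OF c(1)] assms(2) by (auto simp: fatou_defect_def)
qed

lemma cdiff_fatou_defect:
  assumes "q \<in> inner_petal M" "M > 0" "x \<in> cball q 1"
  shows "cdiff pscale (*) (\<lambda>x. fst (fatou_defect x)) x" "cdiff pscale (*) (\<lambda>x. snd (fatou_defect x)) x"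
proof -
  note c = cball_inner_petal[OF assms]
  have P: "cdiff pscale pscale (\<lambda>x. fatou (chart_inv x)) x"
    by (rule cdiff_comp[OF cdiff_chart_inv[OF c(2)] cdiff_fatou_petal[OF c(1)]]) (use assms(2) in simp)
  show "cdiff pscale (*) (\<lambda>x. fst (fatou_defect x)) x"
    unfolding fatou_defect_def fst_diff by (rule cdiff_diff[OF cdiff_comp[OF P cdiff_fst] cdiff_fst])
  show "cdiff pscale (*) (\<lambda>x. snd (fatou_defect x)) x"
    unfolding fatou_defect_def snd_diff by (rule cdiff_diff[OF cdiff_comp[OF P cdiff_snd] cdiff_snd])
qed

lemma fatou_defect_derivative:
  assumes q: "q \<in> inner_petal M" and M: "M > 0"
  obtains D where "(fatou_defect has_derivative D) (at q)" "\<And>c h. D (pscale c h) = pscale c (D h)"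
    "\<And>h. norm (D h) \<le> 1 / 8 * norm h"
proof -
  have q1: "q \<in> cball q 1" by simp
  obtain D1 where D1: "((\<lambda>x. fst (fatou_defect x)) has_derivative D1) (at q)" "\<And>c h. D1 (pscale c h) = c * D1 h"
    using cdiff_fatou_defect(1)[OF q M q1] unfolding cdiff_def by blast
  obtain D2 where D2: "((\<lambda>x. snd (fatou_defect x)) has_derivative D2) (at q)" "\<And>c h. D2 (pscale c h) = c * D2 h"
    using cdiff_fatou_defect(2)[OF q M q1] unfolding cdiff_def by blast
  have b1: "cmod (D1 h) \<le> 1 / 16 * norm h" for h
    using cauchy_estimate[OF cdiff_fatou_defect(1)[OF q M] zero_less_one fatou_defect_small(1)[OF q M] D1(1), of h] by simp
  have b2: "cmod (D2 h) \<le> 1 / 16 * norm h" for h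
    using cauchy_estimate[OF cdiff_fatou_defect(2)[OF q M] zero_less_one fatou_defect_small(2)[OF q M] D2(1), of h] by simp
  have "((\<lambda>x. (fst (fatou_defect x), snd (fatou_defect x))) has_derivative (\<lambda>h. (D1 h, D2 h))) (at q)"
    by (rule has_derivative_Pair[OF D1(1) D2(1)])
  hence "(fatou_defect has_derivative (\<lambda>h. (D1 h, D2 h))) (at q)" by simp
  moreover have "norm (D1 h, D2 h) \<le> 1 / 8 * norm h" for h
    using b1[of h] b2[of h] norm_Pair_le[of "D1 h" "D2 h"] by simp
  ultimately show ?thesis
    using that[of "\<lambda>h. (D1 h, D2 h)"] D1(2) D2(2) by (simp add: pscale_def)
qed

lemma convex_inner_petal: "convex (inner_petal M)"
proof -
  have "inner_petal M = {z. Re z > petal_radius (M + 1) + 1} \<times> ball 0 M"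
    by (auto simp: inner_petal_def)
  thus ?thesis by (simp add: convex_Times convex_halfspace_Re_gt)
qed

lemma fatou_defect_lipschitz:
  assumes "x \<in> inner_petal M" "y \<in> inner_petal M" "M > 0"
  shows "norm (fatou_defect x - fatou_defect y) \<le> 1 / 8 * norm (x - y)"
proof -
  have "\<forall>q. \<exists>D. q \<in> inner_petal M \<longrightarrow> (fatou_defect has_derivative D) (at q) \<and> (\<forall>h. norm (D h) \<le> 1 / 8 * norm h)"
    using fatou_defect_derivative[OF _ assms(3)] by metis
  then obtain D where D: "\<And>q. q \<in> inner_petal M \<Longrightarrow> (fatou_defect has_derivative D q) (at q)"
      "\<And>q h. q \<in> inner_petal M \<Longrightarrow> norm (D q h) \<le> 1 / 8 * norm h"
    by metis
  show ?thesis
  proof (rule differentiable_bound[OF convex_inner_petal _ _ assms(1,2)])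
    show "(fatou_defect has_derivative D q) (at q within inner_petal M)" if "q \<in> inner_petal M" for q
      by (rule has_derivative_at_withinI[OF D(1)[OF that]])
    show "onorm (D q) \<le> 1 / 8" if "q \<in> inner_petal M" for q
      by (rule onorm_bound) (use D(2)[OF that] in auto)
  qed
qed

lemma fatou_chart_inv_inj:
  assumes "x \<in> inner_petal M" "y \<in> inner_petal M" "M > 0" "fatou (chart_inv x) = fatou (chart_inv y)"
  shows "x = y"
proof -
  have "fatou_defect x - fatou_defect y = y - x" using assms(4) by (simp add: fatou_defect_def)
  hence "norm (x - y) \<le> 1 / 8 * norm (x - y)"
    using fatou_defect_lipschitz[OF assms(1-3)] by (simp add: norm_minus_commute)
  thus ?thesis by simp
qed

lemma basin_enters_inner_petal:
  assumes p: "p \<in> base_basin"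
  obtains M0 where "M0 > 0" "\<And>M. M \<ge> M0 \<Longrightarrow> \<forall>\<^sub>F n in sequentially. chart ((base_map ^^ n) p) \<in> inner_petal M"
proof -
  obtain M k where M: "M > 0" and k: "(base_map ^^ k) p \<in> petal M"
    using basin_enters_petal[OF p] by blast
  note orb = petal_orbit[OF k M]
  have "\<forall>\<^sub>F n in sequentially. chart ((base_map ^^ n) p) \<in> inner_petal L" if L: "L \<ge> M + 2" for L
  proof -
    have "\<forall>\<^sub>F n in sequentially. real n > 2 * (petal_radius (L + 1) + 1 - petal_radius M)"
      using filterlim_at_top_dense[THEN iffD1, OF filterlim_real_sequentially] by blast
    hence "\<forall>\<^sub>F n in sequentially. chart ((base_map ^^ (n + k)) p) \<in> inner_petal L"
    proof eventually_elim
      case (elim n)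
      have Gnk: "(base_map ^^ (n + k)) p = (base_map ^^ n) ((base_map ^^ k) p)" by (simp add: funpow_add)
      have "Re (U_coord ((base_map ^^ (n + k)) p)) > petal_radius (L + 1) + 1"
        using orb(1)[of n] elim unfolding Gnk by (simp add: field_simps)
      moreover have "cmod (t_coord ((base_map ^^ (n + k)) p)) < L"
        using orb(2)[of n] L unfolding Gnk by simp
      ultimately show ?case by (simp add: inner_petal_def chart_def)
    qed
    thus ?thesis by (rule eventually_sequentially_seg[where k = k, THEN iffD1])
  qed
  thus ?thesis using that[of "M + 2"] M by simp
qed

lemma inj_base_pow: "inj (base_map ^^ n)"
proof -
  have "inj base_map" using base_inv_base by (metis injI)
  thus ?thesis by (rule inj_fn)
qed

lemma base_pow_base_inv_pow: "(base_map ^^ n) ((base_inv ^^ n) p) = p"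
proof (induction n arbitrary: p)
  case (Suc n)
  have "(base_map ^^ Suc n) ((base_inv ^^ Suc n) p) = base_map ((base_map ^^ n) ((base_inv ^^ n) (base_inv p)))"
    by (simp only: funpow_Suc_right[of n base_inv]) simp
  thus ?case by (simp only: Suc base_base_inv)
qed simp

lemma base_inv_pow_base_pow: "(base_inv ^^ n) ((base_map ^^ n) p) = p"
  by (metis base_pow_base_inv_pow inj_base_pow injD)

text \<open>Two points with the same value have iterates with the same value, and these eventually lie in a
  common inner petal, where the Fatou map is a perturbation of the coordinates with Lipschitz
  constant less than $1$.\<close>
lemma fatou_inj: "inj_on fatou base_basin"
proof (rule inj_onI)
  fix p p' assume p: "p \<in> base_basin" and p': "p' \<in> base_basin" and eq: "fatou p = fatou p'"
  obtain M0 where M0: "M0 > 0" "\<And>M. M \<ge> M0 \<Longrightarrow> \<forall>\<^sub>F n in sequentially. chart ((base_map ^^ n) p) \<in> inner_petal M"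
    using basin_enters_inner_petal[OF p] by blast
  obtain M1 where M1: "M1 > 0" "\<And>M. M \<ge> M1 \<Longrightarrow> \<forall>\<^sub>F n in sequentially. chart ((base_map ^^ n) p') \<in> inner_petal M"
    using basin_enters_inner_petal[OF p'] by blast
  define M where "M = max M0 M1"
  have "\<forall>\<^sub>F n in sequentially. chart ((base_map ^^ n) p) \<in> inner_petal M \<and> chart ((base_map ^^ n) p') \<in> inner_petal M"
    by (intro eventually_conj M0(2) M1(2)) (simp_all add: M_def)
  then obtain n where n: "chart ((base_map ^^ n) p) \<in> inner_petal M" "chart ((base_map ^^ n) p') \<in> inner_petal M"
    using eventually_happens'[OF sequentially_bot] by blast
  have nz: "snd ((base_map ^^ n) p) \<noteq> 0" "snd ((base_map ^^ n) p') \<noteq> 0" using p p' by (simp_all add: base_basin_def)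
  have fatou_eq: "fatou ((base_map ^^ n) p) = fatou ((base_map ^^ n) p')"
    unfolding fatou_base_pow[OF p] fatou_base_pow[OF p'] eq ..
  have "chart ((base_map ^^ n) p) = chart ((base_map ^^ n) p')"
  proof (rule fatou_chart_inv_inj[OF n])
    show "M > 0" using M0(1) by (simp add: M_def)
    show "fatou (chart_inv (chart ((base_map ^^ n) p))) = fatou (chart_inv (chart ((base_map ^^ n) p')))"
      unfolding chart_inv_chart[OF nz(1)] chart_inv_chart[OF nz(2)] by (rule fatou_eq)
  qed
  from arg_cong[OF this, of chart_inv] have "(base_map ^^ n) p = (base_map ^^ n) p'"
    unfolding chart_inv_chart[OF nz(1)] chart_inv_chart[OF nz(2)] .
  thus "p = p'" by (rule injD[OF inj_base_pow])
qed

text \<open>A value $w'$ obtained from the given one by adding a large integer to the first component is attained at a fixed point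
  of $q \mapsto w' - e(q)$, where $e$ is \<open>fatou_defect\<close>; iterating the inverse map takes the
  integer off again.\<close>
lemma fatou_surj: "fatou ` base_basin = UNIV"
proof -
  have "w \<in> fatou ` base_basin" for w
  proof -
    define M where "M = cmod (snd w) + 3"
    have M: "M > 0" by (simp add: M_def add_nonneg_pos)
    obtain n :: nat where n: "real n > petal_radius (M + 1) + 3 - Re (fst w)"
      using reals_Archimedean2 by blast
    define w' where "w' = w + (of_nat n, 0)"
    have sub: "x \<in> inner_petal M" if "x \<in> cball w' 1" for x
    proof -
      have "norm (fst x - fst w') \<le> 1" "norm (snd x - snd w') \<le> 1"
        using that dist_fst_le[of x w'] dist_snd_le[of x w'] by (simp_all add: dist_norm norm_minus_commute[of w'])
      hence "\<bar>Re (fst x - fst w')\<bar> \<le> 1" "cmod (snd x) \<le> cmod (snd w') + 1"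
        using abs_Re_le_cmod[of "fst x - fst w'"] norm_triangle_ineq[of "snd w'" "snd x - snd w'"] by auto
      thus ?thesis using n by (auto simp: inner_petal_def w'_def M_def)
    qed
    obtain q where q: "q \<in> cball w' 1" "w' - fatou_defect q = q"
    proof (rule brouwer_ball[of 1 w' "\<lambda>q. w' - fatou_defect q"])
      have "isCont fatou_defect q" if "q \<in> inner_petal M" for q
        using fatou_defect_derivative[OF that M] has_derivative_continuous by metis
      thus "continuous_on (cball w' 1) (\<lambda>q. w' - fatou_defect q)"
        using sub by (intro continuous_intros continuous_at_imp_continuous_on) auto
      show "(\<lambda>q. w' - fatou_defect q) \<in> cball w' 1 \<rightarrow> cball w' 1"
      proof
        fix q assume "q \<in> cball w' 1"
        hence "cmod (fst (fatou_defect q)) \<le> 1 / 16" "cmod (snd (fatou_defect q)) \<le> 1 / 16"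
          using fatou_defect_small[OF sub M, of q q] by auto
        hence "norm (fatou_defect q) \<le> 1"
          using norm_Pair_le[of "fst (fatou_defect q)" "snd (fatou_defect q)"] by simp
        thus "w' - fatou_defect q \<in> cball w' 1" by (simp add: dist_norm)
      qed
    qed auto
    have "fatou (chart_inv q) = w'" using q(2) by (simp add: fatou_defect_def algebra_simps)
    moreover have "chart_inv q \<in> base_basin"
      using cball_inner_petal(1)[OF sub[OF q(1)] M, of q] M by (intro petal_imp_basin[of _ "M + 1"]) auto
    define p where "p = (base_inv ^^ n) (chart_inv q)"
    have Gp: "(base_map ^^ n) p = chart_inv q" by (simp add: p_def base_pow_base_inv_pow)
    have p: "p \<in> base_basin" using \<open>chart_inv q \<in> base_basin\<close> basin_base_pow_iff[of n p] by (simp add: Gp)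
    have "fatou p = w" using fatou_base_pow[OF p, of n] \<open>fatou (chart_inv q) = w'\<close> by (simp add: Gp w'_def)
    thus ?thesis using p by blast
  qed
  thus ?thesis by blast
qed

lemma basin_open: "open base_basin"
proof (subst open_subopen, intro ballI)
  fix p assume "p \<in> base_basin"
  then obtain M k where M: "M > 0" and k: "(base_map ^^ k) p \<in> petal M"
    using basin_enters_petal by blast
  have "continuous_on UNIV (base_map ^^ k)"
    using cdiff_funpow[OF cdiff_base] cdiff_continuous by (intro continuous_at_imp_continuous_on) blast
  hence "open ((base_map ^^ k) -` petal M)"
    using petal_open[OF M] by (metis continuous_on_open_vimage Int_UNIV_right open_UNIV)
  moreover have "(base_map ^^ k) -` petal M \<subseteq> base_basin"
    using petal_imp_basin[OF _ M] basin_base_pow_iff by blast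
  ultimately show "\<exists>T. open T \<and> p \<in> T \<and> T \<subseteq> base_basin" using k by blast
qed

lemma left_inverse_derivative_injective:
  assumes f: "(f has_derivative D) (at p)" and g: "(g has_derivative D') (at (f p))"
    and U: "open U" "p \<in> U" and inv: "\<And>x. x \<in> U \<Longrightarrow> g (f x) = x"
  shows "D' (D h) = h"
proof -
  have "((\<lambda>x. g (f x)) has_derivative (\<lambda>h. D' (D h))) (at p)"
    by (rule has_derivative_compose[OF f g])
  hence "((\<lambda>x. x) has_derivative (\<lambda>h. D' (D h))) (at p)"
    using U by (rule has_derivative_transform_within_open) (rule inv)
  from has_derivative_unique[OF this has_derivative_ident] show ?thesis by metis
qed

text \<open>Near \<open>p\<close> the Fatou map is a high iterate in the chart, followed by a map whose derivative is within
  $1/8$ of the identity, followed by a translation.\<close>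
lemma fatou_derivative:
  assumes p: "p \<in> base_basin"
  obtains D where "(fatou has_derivative D) (at p)" "\<And>c h. D (pscale c h) = pscale c (D h)" "inj D"
proof -
  obtain M where M: "M > 0" "\<forall>\<^sub>F n in sequentially. chart ((base_map ^^ n) p) \<in> inner_petal M"
    using basin_enters_inner_petal[OF p] by (metis order_refl)
  then obtain n where n: "chart ((base_map ^^ n) p) \<in> inner_petal M"
    using eventually_happens'[OF sequentially_bot] by blast
  define f where "f = (\<lambda>x. chart ((base_map ^^ n) x))"
  define g where "g = (\<lambda>y. (base_inv ^^ n) (chart_inv y))"
  have nz: "snd ((base_map ^^ n) x) \<noteq> 0" if "x \<in> base_basin" for x using that by (simp add: base_basin_def)
  have gf: "g (f x) = x" if "x \<in> base_basin" for x
    using nz[OF that] by (simp add: f_def g_def chart_inv_chart base_inv_pow_base_pow)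
  have fp: "fst (f p) \<noteq> 0" using nz[OF p] by (simp add: f_def chart_def U_coord_def)
  obtain Df where Df: "(f has_derivative Df) (at p)" "\<And>c h. Df (pscale c h) = pscale c (Df h)"
    using cdiff_comp[OF cdiff_funpow[OF cdiff_base] cdiff_chart[OF nz[OF p]]] unfolding cdiff_def f_def by blast
  obtain Dg where Dg: "(g has_derivative Dg) (at (f p))"
    using cdiff_comp[OF cdiff_chart_inv[OF fp] cdiff_funpow[OF cdiff_base_inv]] unfolding cdiff_def g_def by blast
  have "inj Df"
    using left_inverse_derivative_injective[OF Df(1) Dg basin_open p gf] by (metis injI)
  obtain De where De: "(fatou_defect has_derivative De) (at (f p))" "\<And>c h. De (pscale c h) = pscale c (De h)"
      "\<And>h. norm (De h) \<le> 1 / 8 * norm h"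
    using fatou_defect_derivative[OF n[folded f_def[THEN fun_cong]] M(1)] by blast
  define D where "D = (\<lambda>h. Df h + De (Df h))"
  have "((\<lambda>x. f x + fatou_defect (f x) - (of_nat n, 0)) has_derivative (\<lambda>h. D h - 0)) (at p)"
    unfolding D_def
    by (rule has_derivative_diff[OF has_derivative_add[OF Df(1) has_derivative_compose[OF Df(1) De(1)]] has_derivative_const])
  hence "(fatou has_derivative (\<lambda>h. D h - 0)) (at p)"
    using basin_open p
  proof (rule has_derivative_transform_within_open)
    fix x assume x: "x \<in> base_basin"
    show "f x + fatou_defect (f x) - (of_nat n, 0) = fatou x"
      using fatou_base_pow[OF x, of n] nz[OF x] by (simp add: fatou_defect_def f_def chart_inv_chart)
  qed
  hence 1: "(fatou has_derivative D) (at p)" by simp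
  have 2: "D (pscale c h) = pscale c (D h)" for c h
    by (simp add: D_def Df(2) De(2)) (simp add: pscale_def distrib_left)
  have lin: "linear D" using has_derivative_linear[OF 1] .
  have "inj D"
    unfolding linear_injective_0[OF lin]
  proof (intro allI impI)
    fix h assume "D h = 0"
    hence "norm (Df h) = norm (De (Df h))" by (simp add: D_def add_eq_0_iff)
    hence "norm (Df h) = 0" using De(3)[of "Df h"] norm_ge_zero[of "Df h"] by linarith
    hence "Df h = Df 0" using linear_0[OF has_derivative_linear[OF Df(1)]] by simp
    thus "h = 0" using \<open>inj Df\<close> by (metis injD)
  qed
  with 1 2 that show ?thesis by blast
qed

lemma cdiff_fatou: "p \<in> base_basin \<Longrightarrow> cdiff pscale pscale fatou p"
  using fatou_derivative unfolding cdiff_def by metis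

lemma cdiff_fatou_inverse: "cdiff pscale pscale (inv_into base_basin fatou) w"
proof -
  obtain p where p: "p \<in> base_basin" "fatou p = w" using fatou_surj by (metis UNIV_I imageE)
  obtain D where D: "(fatou has_derivative D) (at p)" "\<And>c h. D (pscale c h) = pscale c (D h)" "inj D"
    using fatou_derivative[OF p(1)] by blast
  have lin: "linear D" using has_derivative_linear[OF D(1)] .
  have "surj D" by (rule linear_injective_imp_surjective[OF lin D(3)]) simp
  hence DD: "D (inv D h) = h" "inv D (D h) = h" for h
    using D(3) by (simp_all add: surj_f_inv_f)
  have "(inv_into base_basin fatou has_derivative inv D) (at (fatou p))"
  proof (rule has_derivative_inverse_strong[OF basin_open p(1) _ _ D(1)])
    show "continuous_on base_basin fatou"
      using cdiff_fatou cdiff_continuous by (intro continuous_at_imp_continuous_on) blast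
    show "inv_into base_basin fatou (fatou x) = x" if "x \<in> base_basin" for x
      using fatou_inj that by (rule inv_into_f_f)
    show "D \<circ> inv D = id" using DD by auto
  qed
  moreover have "inv D (pscale c h) = pscale c (inv D h)" for c h
    using D(2)[of c "inv D h"] DD by metis
  ultimately show ?thesis unfolding p(2) by (rule cdiffI)
qed

section \<open>Lifting to higher dimension\<close>

lemma biholomorphism_of_inverse:
  fixes f :: "complex ^ 'n::finite \<Rightarrow> complex ^ 'm::finite"
  assumes "open U" "open V"
    and f: "\<And>x. x \<in> U \<Longrightarrow> f x \<in> V" "\<And>x. x \<in> U \<Longrightarrow> cdiff (*s) (*s) f x"
    and g: "\<And>y. y \<in> V \<Longrightarrow> g y \<in> U" "\<And>y. y \<in> V \<Longrightarrow> cdiff (*s) (*s) g y"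
    and gf: "\<And>x. x \<in> U \<Longrightarrow> g (f x) = x" and fg: "\<And>y. y \<in> V \<Longrightarrow> f (g y) = y"
  shows "biholomorphism f U V"
proof -
  have bij: "bij_betw f U V"
    by (rule bij_betw_byWitness[where f' = g]) (use f(1) g(1) gf fg in auto)
  have inv: "g y = inv_into U f y" if "y \<in> V" for y
    using inv_into_f_f[OF bij_betw_imp_inj_on[OF bij] g(1)[OF that]] by (simp add: fg[OF that])
  have "cdiff (*s) (*s) (inv_into U f) y" if "y \<in> V" for y
    using g(2)[OF that] assms(2) that inv by (rule cdiff_transform)
  with bij f(2) assms(1,2) show ?thesis
    by (simp add: biholomorphism_def holomorphic_map_on_iff_cdiff)
qed

definition coord_prod :: "'k \<Rightarrow> complex ^ 'k::finite \<Rightarrow> complex" where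
  "coord_prod a X = (\<Prod>i\<in>-{a}. X $ i)"

text \<open>The quotient map for the action of $(\mathbb{C}^*)^{k - 2}$ on the coordinates other than \<open>a\<close> by
  diagonal matrices of determinant $1$.\<close>
definition quotient :: "'k \<Rightarrow> complex ^ 'k::finite \<Rightarrow> complex \<times> complex" where
  "quotient a X = (X $ a, coord_prod a X)"

text \<open>A logarithm of $v' / v$, divided by \<open>N\<close>, with $v'$ the second component of the planar map.\<close>
definition log_rate :: "nat \<Rightarrow> complex \<Rightarrow> complex \<Rightarrow> complex" where
  "log_rate N u v = ((u - u\<^sup>2 / 2) - ((u + v * factor u) - (u + v * factor u)\<^sup>2 / 2)) / of_nat N"

definition lift_map :: "'k \<Rightarrow> complex ^ 'k::finite \<Rightarrow> complex ^ 'k" where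
  "lift_map a X = (\<chi> i. if i = a then fst (base_map (quotient a X))
     else X $ i * exp (log_rate (CARD('k) - 1) (X $ a) (coord_prod a X)))"

definition lift_inv :: "'k \<Rightarrow> complex ^ 'k::finite \<Rightarrow> complex ^ 'k" where
  "lift_inv a Y = (let q = base_inv (quotient a Y) in
     \<chi> i. if i = a then fst q else Y $ i * exp (- log_rate (CARD('k) - 1) (fst q) (snd q)))"

lemma exp_log_rate_pow:
  assumes "N > 0" shows "exp (log_rate N u v) ^ N = factor u / factor (u + v * factor u)"
proof -
  have "exp (log_rate N u v) ^ N = exp (of_nat N * log_rate N u v)"
    by (rule exp_of_nat_mult[symmetric])
  also have "of_nat N * log_rate N u v = (u - u\<^sup>2 / 2) - ((u + v * factor u) - (u + v * factor u)\<^sup>2 / 2)"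
    using assms by (simp add: log_rate_def)
  also have "exp \<dots> = factor u / factor (u + v * factor u)"
    unfolding factor_def[of u] factor_def[of "u + v * exp (u - u\<^sup>2 / 2)"] exp_diff[of "u - u\<^sup>2 / 2"] ..
  finally show ?thesis .
qed

lemma base_snd_eq_log_rate: "N > 0 \<Longrightarrow> base_snd u v = v * exp (log_rate N u v) ^ N"
  by (simp add: exp_log_rate_pow base_snd_def)

lemma card_Compl_singleton: "card (-{a} :: 'k::finite set) = CARD('k) - 1"
  by (simp add: Compl_eq_Diff_UNIV card_Diff_subset)

definition lift_fatou :: "'k \<Rightarrow> 'k \<Rightarrow> complex ^ 'k::finite \<Rightarrow> complex ^ 'k" where
  "lift_fatou a j X = (\<chi> i. if i = a then fst (fatou (quotient a X)) else if i = j then snd (fatou (quotient a X)) else X $ i)"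

definition lift_fatou_inv :: "'k \<Rightarrow> 'k \<Rightarrow> complex ^ 'k::finite \<Rightarrow> complex ^ 'k" where
  "lift_fatou_inv a j Y = (let q = inv_into base_basin fatou (Y $ a, Y $ j) in
     \<chi> i. if i = a then fst q else if i = j then snd q / (\<Prod>l\<in>-{a, j}. Y $ l) else Y $ i)"

context
  fixes a :: "'k::finite"
  assumes card: "CARD('k) \<ge> 2"
begin

lemma coord_prod_0 [simp]: "coord_prod a 0 = 0"
  using card by (simp add: coord_prod_def card_Compl_singleton)

lemma coord_prod_scale:
  assumes "\<And>i. i \<noteq> a \<Longrightarrow> Y $ i = X $ i * c" shows "coord_prod a Y = coord_prod a X * c ^ (CARD('k) - 1)"
proof -
  have "coord_prod a Y = (\<Prod>i\<in>-{a}. X $ i * c)"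
    unfolding coord_prod_def by (rule prod.cong) (use assms in auto)
  thus ?thesis by (simp add: prod.distrib coord_prod_def card_Compl_singleton)
qed

lemma quotient_lift: "quotient a (lift_map a X) = base_map (quotient a X)"
proof -
  have "coord_prod a (lift_map a X) = coord_prod a X * exp (log_rate (CARD('k) - 1) (X $ a) (coord_prod a X)) ^ (CARD('k) - 1)"
    by (rule coord_prod_scale) (simp add: lift_map_def)
  also have "\<dots> = base_snd (X $ a) (coord_prod a X)"
    using card by (intro base_snd_eq_log_rate[symmetric]) simp
  finally show ?thesis by (simp add: quotient_def base_map_def lift_map_def)
qed

lemma quotient_lift_inv: "quotient a (lift_inv a Y) = base_inv (quotient a Y)"
proof -
  obtain u v where uv: "base_inv (quotient a Y) = (u, v)" by fastforce
  have N: "CARD('k) - 1 > 0" using card by simp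
  define r where "r = exp (log_rate (CARD('k) - 1) u v)"
  have "coord_prod a (lift_inv a Y) = coord_prod a Y * (inverse r) ^ (CARD('k) - 1)"
    by (rule coord_prod_scale) (simp add: lift_inv_def Let_def uv r_def exp_minus)
  moreover have "coord_prod a Y = base_snd u v"
    using arg_cong[OF base_base_inv[of "quotient a Y"], of snd] unfolding uv by (simp add: quotient_def base_map_def)
  moreover have "r \<noteq> 0" by (simp add: r_def)
  ultimately have "coord_prod a (lift_inv a Y) = v"
    using base_snd_eq_log_rate[OF N, of u v, folded r_def] by (simp add: power_inverse)
  moreover have "lift_inv a Y $ a = u" by (simp add: lift_inv_def Let_def uv)
  ultimately show ?thesis unfolding uv by (simp add: quotient_def)
qed

lemma lift_inv_lift: "lift_inv a (lift_map a X) = X"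
proof -
  have "exp x * exp (- x) = 1" for x :: complex by (simp add: exp_minus)
  hence "lift_map a X $ i * exp (- log_rate (CARD('k) - 1) (X $ a) (coord_prod a X)) = X $ i" if "i \<noteq> a" for i
    using that by (simp add: lift_map_def mult.assoc)
  thus ?thesis
    by (simp add: vec_eq_iff lift_inv_def Let_def quotient_lift base_inv_base) (simp add: quotient_def)
qed

lemma lift_lift_inv: "lift_map a (lift_inv a Y) = Y"
proof -
  obtain u v where uv: "base_inv (quotient a Y) = (u, v)" by fastforce
  have q: "lift_inv a Y $ a = u" "coord_prod a (lift_inv a Y) = v"
    using quotient_lift_inv[of Y] unfolding uv by (simp_all add: quotient_def)
  have "exp (- x) * exp x = 1" for x :: complex by (simp add: exp_minus)
  hence "lift_inv a Y $ i * exp (log_rate (CARD('k) - 1) u v) = Y $ i" if "i \<noteq> a" for i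
    using that by (simp add: lift_inv_def Let_def uv mult.assoc)
  moreover have "fst (base_map (quotient a (lift_inv a Y))) = Y $ a"
    by (simp add: quotient_lift_inv base_base_inv) (simp add: quotient_def)
  ultimately show ?thesis
    by (simp add: vec_eq_iff lift_map_def q)
qed

lemma cdiff_coord_prod: "cdiff (*s) (*) (coord_prod a) X"
  unfolding coord_prod_def by (intro cdiff_prod cdiff_nth)

lemma cdiff_quotient: "cdiff (*s) pscale (quotient a) X"
  unfolding quotient_def by (intro cdiff_Pair cdiff_nth cdiff_coord_prod)

lemma cdiff_log_rate:
  assumes "cdiff s (*) f p" "cdiff s (*) g p" "N > 0" shows "cdiff s (*) (\<lambda>x. log_rate N (f x) (g x)) p"
  unfolding log_rate_def
  by (intro cdiff_divide cdiff_diff cdiff_add cdiff_mult cdiff_power cdiff_factor cdiff_const assms(1,2))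
     (use assms(3) in auto)

lemma cdiff_lift: "cdiff (*s) (*s) (lift_map a) X"
proof (rule cdiff_vec)
  fix i
  have N: "CARD('k) - 1 > 0" using card by simp
  show "cdiff (*s) (*) (\<lambda>x. lift_map a x $ i) X"
  proof (cases "i = a")
    case True
    thus ?thesis
      using cdiff_base_fst[OF cdiff_nth cdiff_coord_prod, of a X] by (simp add: lift_map_def base_map_def quotient_def)
  next
    case False
    thus ?thesis
      using cdiff_mult[OF cdiff_nth cdiff_exp[OF cdiff_log_rate[OF cdiff_nth cdiff_coord_prod N]], of i a X]
      by (simp add: lift_map_def)
  qed
qed

lemma cdiff_lift_inv: "cdiff (*s) (*s) (lift_inv a) Y"
proof (rule cdiff_vec)
  fix i
  have N: "CARD('k) - 1 > 0" using card by simp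
  have q: "cdiff (*s) pscale (\<lambda>Y. base_inv (quotient a Y)) Y"
    by (rule cdiff_comp[OF cdiff_quotient cdiff_base_inv])
  note q1 = cdiff_comp[OF q cdiff_fst] and q2 = cdiff_comp[OF q cdiff_snd]
  show "cdiff (*s) (*) (\<lambda>x. lift_inv a x $ i) Y"
  proof (cases "i = a")
    case True
    thus ?thesis using q1 by (simp add: lift_inv_def Let_def)
  next
    case False
    thus ?thesis
      using cdiff_mult[OF cdiff_nth cdiff_exp[OF cdiff_minus[OF cdiff_log_rate[OF q1 q2 N]]], of i]
      by (simp add: lift_inv_def Let_def)
  qed
qed

lemma lift_automorphism: "holomorphic_automorphism (lift_map a)"
  unfolding holomorphic_automorphism_def
  by (rule biholomorphism_of_inverse[where g = "lift_inv a"])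
     (simp_all add: cdiff_lift cdiff_lift_inv lift_inv_lift lift_lift_inv)

text \<open>The coordinates other than \<open>a\<close> are multiplied by a function with value $1$ at the origin. In the
  coordinate \<open>a\<close>, both $v E(u)$ and $v'$ are $v$ to first order, and they cancel.\<close>
lemma lift_tangent: "tangent_to_identity (lift_map a)"
  unfolding tangent_to_identity_def
proof
  show F0: "lift_map a 0 = 0"
    by (simp add: vec_eq_iff lift_map_def quotient_def base_map_def base_fst_def base_snd_def)
  have N: "CARD('k) - 1 > 0" using card by simp
  obtain L where L: "(coord_prod a has_derivative L) (at 0)"
    using cdiff_coord_prod unfolding cdiff_def by blast
  have nth: "((\<lambda>X :: complex ^ 'k. X $ i) has_derivative (\<lambda>h. h $ i)) (at 0)" for i
    by (rule bounded_linear.has_derivative[OF bounded_linear_vec_nth has_derivative_ident])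
  show "(lift_map a has_derivative (\<lambda>v. v)) (at 0)"
  proof (rule has_derivative_vecI)
    fix i
    show "((\<lambda>X. lift_map a X $ i) has_derivative (\<lambda>h. h $ i)) (at 0)"
    proof (cases "i = a")
      case False
      obtain D where D: "((\<lambda>X. exp (log_rate (CARD('k) - 1) (X $ a) (coord_prod a X))) has_derivative D) (at 0)"
        using cdiff_exp[OF cdiff_log_rate[OF cdiff_nth cdiff_coord_prod N]] unfolding cdiff_def by blast
      have "log_rate (CARD('k) - 1) 0 0 = 0" by (simp add: log_rate_def)
      thus ?thesis
        using has_derivative_mult[OF nth[of i] D] False by (simp add: lift_map_def)
    next
      case True
      have c: "cdiff (*s) (*) (\<lambda>X. factor (X $ a)) 0" "cdiff (*s) (*) (\<lambda>X. factor (X $ a) / factor (X $ a + coord_prod a X * factor (X $ a))) 0"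
        by (intro cdiff_divide cdiff_add cdiff_mult cdiff_factor cdiff_nth cdiff_coord_prod factor_nonzero)+
      obtain D1 where D1: "((\<lambda>X. factor (X $ a)) has_derivative D1) (at 0)"
        using c(1) unfolding cdiff_def by blast
      obtain D2 where D2: "((\<lambda>X. factor (X $ a) / factor (X $ a + coord_prod a X * factor (X $ a))) has_derivative D2) (at 0)"
        using c(2) unfolding cdiff_def by blast
      have V: "((\<lambda>X. coord_prod a X * factor (X $ a)) has_derivative L) (at 0)"
        using has_derivative_mult[OF L D1] by simp
      \<comment> \<open>$V$ and $v'$ have the same derivative \<open>L\<close> as $v$: each is $v$ times a function with value $1$ at $0$\<close>
      have S: "((\<lambda>X. base_snd (X $ a) (coord_prod a X)) has_derivative L) (at 0)"
        using has_derivative_mult[OF L D2] by (simp add: base_snd_def)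
      have S2: "((\<lambda>X. (base_snd (X $ a) (coord_prod a X))\<^sup>2) has_derivative (\<lambda>h. 0)) (at 0)"
        using has_derivative_mult[OF S S] by (simp add: power2_eq_square base_snd_def)
      obtain D3 where D3: "((\<lambda>X. exp (- 2 * base_snd (X $ a) (coord_prod a X))) has_derivative D3) (at 0)"
        using cdiff_exp[OF cdiff_mult[OF cdiff_const cdiff_base_snd[OF cdiff_nth cdiff_coord_prod]]]
        unfolding cdiff_def by blast
      have "((\<lambda>X. X $ a + coord_prod a X * factor (X $ a) - base_snd (X $ a) (coord_prod a X) - (base_snd (X $ a) (coord_prod a X))\<^sup>2)
          has_derivative (\<lambda>h. h $ a + L h - L h - 0)) (at 0)"
        by (rule has_derivative_diff[OF has_derivative_diff[OF has_derivative_add[OF nth V] S] S2])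
      from has_derivative_mult[OF this D3]
      have "((\<lambda>X. base_fst (X $ a) (coord_prod a X)) has_derivative (\<lambda>h. h $ a)) (at 0)"
        by (simp add: base_fst_def base_snd_def)
      thus ?thesis using True by (simp add: lift_map_def quotient_def base_map_def)
    qed
  qed
qed

lemma quotient_lift_pow: "quotient a ((lift_map a ^^ n) X) = (base_map ^^ n) (quotient a X)"
  by (induction n) (simp_all add: quotient_lift)

lemma lift_pow_coord:
  assumes "i \<noteq> a"
  shows "((lift_map a ^^ n) X $ i) ^ (CARD('k) - 1) * coord_prod a X = (X $ i) ^ (CARD('k) - 1) * coord_prod a ((lift_map a ^^ n) X)"
proof (induction n)
  case (Suc n)
  define Y where "Y = (lift_map a ^^ n) X"
  define r where "r = exp (log_rate (CARD('k) - 1) (Y $ a) (coord_prod a Y)) ^ (CARD('k) - 1)"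
  have "(lift_map a Y $ i) ^ (CARD('k) - 1) = (Y $ i) ^ (CARD('k) - 1) * r"
    using assms by (simp add: lift_map_def r_def power_mult_distrib)
  moreover have "coord_prod a (lift_map a Y) = coord_prod a Y * r"
    unfolding r_def by (rule coord_prod_scale) (simp add: lift_map_def)
  ultimately show ?case using Suc by (simp add: mult.commute mult.left_commute flip: Y_def)
qed simp

lemma lift_fixes_hypersurface:
  assumes "coord_prod a X = 0" shows "lift_map a X = X"
proof -
  have "log_rate N u 0 = 0" "base_fst u 0 = u" for N u
    by (simp_all add: log_rate_def base_fst_def base_snd_def)
  thus ?thesis
    using assms by (simp add: vec_eq_iff lift_map_def quotient_def base_map_def)
qed

text \<open>Points with $v = 0$ are fixed. For the others, the power identity \<open>lift_pow_coord\<close> converts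
  convergence of $v_n$ to $0$ into convergence of all remaining coordinates.\<close>
lemma basin_lift: "basin_of_attraction (lift_map a) = quotient a -` base_basin"
proof (rule set_eqI)
  fix X :: "complex ^ 'k"
  have N: "CARD('k) - 1 > 0" using card by simp
  have quot0: "quotient a 0 = 0" by (simp add: quotient_def zero_prod_def)
  have cont: "isCont (quotient a) 0" by (rule cdiff_continuous[OF cdiff_quotient])
  show "X \<in> basin_of_attraction (lift_map a) \<longleftrightarrow> X \<in> quotient a -` base_basin"
  proof
    assume X: "X \<in> basin_of_attraction (lift_map a)"
    hence lim: "(\<lambda>n. (lift_map a ^^ n) X) \<longlonglongrightarrow> 0" by (simp add: basin_of_attraction_def)
    have "coord_prod a X \<noteq> 0"
    proof
      assume "coord_prod a X = 0"
      hence "(lift_map a ^^ n) X = X" for n by (induction n) (simp_all add: lift_fixes_hypersurface)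
      hence "X = 0" using lim LIMSEQ_const_iff[of X 0] by simp
      thus False using X by (simp add: basin_of_attraction_def)
    qed
    moreover have "(\<lambda>n. quotient a ((lift_map a ^^ n) X)) \<longlonglongrightarrow> quotient a 0"
      by (rule isCont_tendsto_compose[OF cont lim])
    ultimately show "X \<in> quotient a -` base_basin"
      unfolding quot0 by (simp add: base_basin_def quotient_lift_pow) (simp add: quotient_def)
  next
    assume X: "X \<in> quotient a -` base_basin"
    hence P: "coord_prod a X \<noteq> 0" and "(\<lambda>n. quotient a ((lift_map a ^^ n) X)) \<longlonglongrightarrow> 0"
      by (simp_all add: base_basin_def quotient_lift_pow) (simp add: quotient_def)
    from tendsto_fst[OF this(2)] tendsto_snd[OF this(2)]
    have ulim: "(\<lambda>n. (lift_map a ^^ n) X $ a) \<longlonglongrightarrow> 0" and vlim: "(\<lambda>n. coord_prod a ((lift_map a ^^ n) X)) \<longlonglongrightarrow> 0"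
      by (simp_all add: quotient_def)
    have "(\<lambda>n. (lift_map a ^^ n) X $ i) \<longlonglongrightarrow> 0 $ i" for i
    proof (cases "i = a")
      case False
      have "((lift_map a ^^ n) X $ i) ^ (CARD('k) - 1) = (X $ i) ^ (CARD('k) - 1) / coord_prod a X * coord_prod a ((lift_map a ^^ n) X)" for n
        using lift_pow_coord[OF False, of n X] P by (simp add: field_simps)
      moreover have "(\<lambda>n. (X $ i) ^ (CARD('k) - 1) / coord_prod a X * coord_prod a ((lift_map a ^^ n) X)) \<longlonglongrightarrow> 0"
        by (rule tendsto_mult_right_zero[OF vlim])
      ultimately have "(\<lambda>n. ((lift_map a ^^ n) X $ i) ^ (CARD('k) - 1)) \<longlonglongrightarrow> 0"
        by simp
      from tendsto_norm_zero[OF this] have pw: "(\<lambda>n. cmod ((lift_map a ^^ n) X $ i) ^ (CARD('k) - 1)) \<longlonglongrightarrow> 0"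
        by (simp add: norm_power)
      have "(\<lambda>n. (lift_map a ^^ n) X $ i) \<longlonglongrightarrow> 0"
        unfolding tendsto_iff
      proof (intro allI impI)
        fix e :: real assume e: "e > 0"
        have "\<forall>\<^sub>F n in sequentially. cmod ((lift_map a ^^ n) X $ i) ^ (CARD('k) - 1) < e ^ (CARD('k) - 1)"
          using order_tendstoD(2)[OF pw] e by simp
        thus "\<forall>\<^sub>F n in sequentially. dist ((lift_map a ^^ n) X $ i) 0 < e"
        proof eventually_elim
          case (elim n)
          thus ?case using e power_less_imp_less_base[of "cmod ((lift_map a ^^ n) X $ i)" _ e] by simp
        qed
      qed
      thus ?thesis by simp
    qed (simp add: ulim)
    hence "(\<lambda>n. (lift_map a ^^ n) X) \<longlonglongrightarrow> 0" by (rule vec_tendstoI)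
    moreover have "X \<noteq> 0" using P by auto
    ultimately show "X \<in> basin_of_attraction (lift_map a)" by (simp add: basin_of_attraction_def)
  qed
qed

lemma open_basin_lift: "open (basin_of_attraction (lift_map a))"
proof -
  have "continuous_on UNIV (quotient a)"
    using cdiff_quotient cdiff_continuous by (intro continuous_at_imp_continuous_on) blast
  thus ?thesis
    unfolding basin_lift using basin_open by (metis continuous_on_open_vimage Int_UNIV_right open_UNIV)
qed

lemma open_punctured_coords: "open (punctured_coords S)"
proof -
  have "punctured_coords S = {z. (\<Prod>i\<in>S. z $ i) \<noteq> 0}"
    by (auto simp: punctured_coords_def)
  also have "open \<dots>"
    by (intro open_Collect_neq continuous_intros)
  finally show ?thesis .
qed

lemma coord_prod_split:
  assumes "j \<noteq> a" shows "coord_prod a X = X $ j * (\<Prod>l\<in>-{a, j}. X $ l)"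
proof -
  have "-{a} = insert j (-{a, j})" using assms by auto
  thus ?thesis by (simp add: coord_prod_def)
qed

lemma lift_fatou_biholomorphism:
  assumes j: "j \<noteq> a"
  shows "biholomorphism (lift_fatou a j) (basin_of_attraction (lift_map a)) (punctured_coords (-{a, j}))"
proof (rule biholomorphism_of_inverse[where g = "lift_fatou_inv a j"])
  show "open (basin_of_attraction (lift_map a))" by (rule open_basin_lift)
  show "open (punctured_coords (-{a, j}))" by (rule open_punctured_coords)
next
  fix X assume "X \<in> basin_of_attraction (lift_map a)"
  hence q: "quotient a X \<in> base_basin" by (simp add: basin_lift)
  hence "coord_prod a X \<noteq> 0" by (simp add: base_basin_def quotient_def)
  hence nz: "X $ j \<noteq> 0" "(\<Prod>l\<in>-{a, j}. X $ l) \<noteq> 0" by (simp_all add: coord_prod_split[OF j])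
  thus "lift_fatou a j X \<in> punctured_coords (-{a, j})"
    by (auto simp: punctured_coords_def lift_fatou_def)
  have fatou: "cdiff (*s) pscale (\<lambda>X. fatou (quotient a X)) X"
    by (rule cdiff_comp[OF cdiff_quotient cdiff_fatou[OF q]])
  show "cdiff (*s) (*s) (lift_fatou a j) X"
  proof (rule cdiff_vec)
    fix i
    show "cdiff (*s) (*) (\<lambda>x. lift_fatou a j x $ i) X"
      using cdiff_comp[OF fatou cdiff_fst] cdiff_comp[OF fatou cdiff_snd] cdiff_nth[of i X]
      by (cases "i = a"; cases "i = j") (simp_all add: lift_fatou_def)
  qed
  have "(\<Prod>l\<in>-{a, j}. lift_fatou a j X $ l) = (\<Prod>l\<in>-{a, j}. X $ l)"
    by (rule prod.cong) (auto simp: lift_fatou_def)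
  moreover have "inv_into base_basin fatou (lift_fatou a j X $ a, lift_fatou a j X $ j) = quotient a X"
    using inv_into_f_f[OF fatou_inj q] j by (simp add: lift_fatou_def)
  ultimately show "lift_fatou_inv a j (lift_fatou a j X) = X"
    using nz j by (auto simp: vec_eq_iff lift_fatou_inv_def Let_def quotient_def coord_prod_split[OF j] lift_fatou_def)
next
  fix Y :: "complex ^ 'k" assume Y: "Y \<in> punctured_coords (-{a, j})"
  define q where "q = inv_into base_basin fatou (Y $ a, Y $ j)"
  have q: "q \<in> base_basin" "fatou q = (Y $ a, Y $ j)"
    unfolding q_def by (rule inv_into_into, simp add: fatou_surj) (rule f_inv_into_f, simp add: fatou_surj)
  have nz: "(\<Prod>l\<in>-{a, j}. Y $ l) \<noteq> 0" using Y by (simp add: punctured_coords_def)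
  have "(\<Prod>l\<in>-{a, j}. lift_fatou_inv a j Y $ l) = (\<Prod>l\<in>-{a, j}. Y $ l)"
    by (rule prod.cong) (auto simp: lift_fatou_inv_def Let_def)
  hence quotient: "quotient a (lift_fatou_inv a j Y) = q"
    using nz j by (simp add: quotient_def coord_prod_split[OF j]) (simp add: lift_fatou_inv_def Let_def flip: q_def)
  show "lift_fatou_inv a j Y \<in> basin_of_attraction (lift_map a)" using quotient q by (simp add: basin_lift)
  show "lift_fatou a j (lift_fatou_inv a j Y) = Y"
    unfolding lift_fatou_def quotient q(2) using j by (simp add: vec_eq_iff lift_fatou_inv_def Let_def)
  have inv: "cdiff (*s) pscale (\<lambda>Y. inv_into base_basin fatou (Y $ a, Y $ j)) Y"
    by (rule cdiff_comp[OF cdiff_Pair[OF cdiff_nth cdiff_nth] cdiff_fatou_inverse])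
  show "cdiff (*s) (*s) (lift_fatou_inv a j) Y"
  proof (rule cdiff_vec)
    fix i
    show "cdiff (*s) (*) (\<lambda>x. lift_fatou_inv a j x $ i) Y"
      using cdiff_comp[OF inv cdiff_fst] cdiff_nth[of i Y]
        cdiff_divide[OF cdiff_comp[OF inv cdiff_snd] cdiff_prod[OF cdiff_nth] nz]
      by (cases "i = a"; cases "i = j") (simp_all add: lift_fatou_inv_def Let_def)
  qed
qed

end

theorem mainTheorem1:
  assumes "CARD('k::finite) \<ge> 3"
  shows "\<exists>F :: complex ^ 'k \<Rightarrow> complex ^ 'k.
           holomorphic_automorphism F \<and> tangent_to_identity F \<and>
           open (basin_of_attraction F) \<and>
           (\<exists>S :: 'k set. card S = CARD('k) - 2 \<and>
              biholomorphic (basin_of_attraction F) (punctured_coords S))"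
proof -
  have card: "CARD('k) \<ge> 2" using assms by simp
  have "\<exists>a j :: 'k. j \<noteq> a"
  proof (rule ccontr)
    assume "\<not> ?thesis"
    hence "UNIV = {undefined :: 'k}" by auto
    hence "CARD('k) = 1" by (metis card_1_singleton_iff One_nat_def)
    thus False using card by simp
  qed
  then obtain a j :: 'k where j: "j \<noteq> a" by blast
  have "card (-{a, j}) = CARD('k) - 2" using j by (simp add: Compl_eq_Diff_UNIV card_Diff_subset)
  moreover have "biholomorphic (basin_of_attraction (lift_map a)) (punctured_coords (-{a, j}))"
    unfolding biholomorphic_def using lift_fatou_biholomorphism[OF card j] by blast
  ultimately show ?thesis
    using lift_automorphism[OF card] lift_tangent[OF card] open_basin_lift[OF card] by blast
qed

end
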